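(* Let $K=(X,\delta,m)$ be a cell complex and $k\in\mathbb{N}_0$ with $X_k\neq\emptyset$. Then $$\max_{K'\le_k K}\ \min_{x\in X_k}F'(x)=\min_J \operatorname{Tr}(\delta\delta^*J),$$ where $F'$ is the Forman curvature of $K'$ and the minimum on the right is taken over all linear $J:C(X_k)\to C(X_k)$ satisfying (a) $\dfrac{Jx(x)}{m(x)}\ge\dfrac{|Jy(x)|}{m(y)}$ for all $x,y\in X_k$, (b) $\delta J\delta^*z(z)\le 0$ for all $z\in X_{k+1}$, (c) $\operatorname{Tr}(J)=1$. Moreover, for linear $J:C(X_k)\to C(X_k)$, condition (a) is equivalent to (a') for all $x\in X_k$ and $f\in C(X_k)$: $Jf(x)\ge 0$ whenever $2\langle x,f\rangle\ge\|f\|_1$.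
   Context: For a finite set $X$, $C(X)=\mathbb{R}^X$, and $x\in X$ is identified with its indicator function $1_x\in C(X)$. A cell complex $K=(X,\delta,m)$ consists of a finite set of cells $X=\dot\bigcup_{k\ge 0}X_k$, a linear operator $\delta:C(X)\to C(X)$ (coboundary) and a weight $m:X\to(0,\infty)$. Write $\dim(z)=k$ iff $z\in X_k$, and $x\lessdot z$ (equivalently $z\gtrdot x$) iff $\delta x(z)\ne 0$. It is required that for all $v,z,z'\in X$: $\delta v(z)\in\{-1,0,1\}$; $\delta v(z)=0$ if $\dim(z)-\dim(v)\ne 1$; if $\dim(z)\ge 1$ there exists $x\lessdot z$; and (i) for every $x\in X_1$ there is exactly one $w\in X_0$ with $\delta w(x)=1$ and exactly one $w\in X_0$ with $\delta w(x)=-1$; (ii) if $\dim(z)-\dim(v)=2$ and $\{x:v\lessdot x\lessdot z\}\ne\emptyset$, then $|\{x:v\lessdot x\lessdot z\}|=2$ and $\{\delta v(x)\,\delta x(z):x\in X\}\supseteq\{-1,1\}$ (hence $\delta\delta=0$); (iii) if $\dim(z)\ge 2$ and $x,y\lessdot z$, there is a sequence $x=x_0,\dots,x_n=y$ of cells in $\{u:u\lessdot z\}\cup\{v: v\lessdot u\lessdot z\text{ for some }u\}$ with $\delta x_i(x_{i-1})+\delta x_{i-1}(x_i)\ne0$ for $i=1,\dots,n$; (iv) if $\{x:x\lessdot z\}=\{x:x\lessdot z'\}$ and $\dim(z)\ge 1$, then $z=z'$. $C(X)$ carries the scalar product $\langle f,g\rangle=\sum_{x\in X}f(x)g(x)m(x)$,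 $\delta^*$ is the adjoint of $\delta$, $\|f\|_1=\sum_x m(x)|f(x)|$, and $H=\delta\delta^*+\delta^*\delta$ is the Hodge Laplacian. The Forman curvature of $x\in X$ is $F(x)=Hx(x)-\sum_{y\ne x}|Hy(x)|$. For cell complexes $K=(X,\delta,m)$, $K'=(X',\delta',m')$ write $K'\le_k K$ if $X'_j=X_j$ for $j\le k$, $X'_j\subseteq X_j$ for $j>k$, $m(x)=m'(x)$ whenever $\dim(x)\le k$, and $\delta'v(x)=\delta v(x)$ for all $v,x\in X'$. (The weights of cells of dimension $>k$ may differ.) The Forman curvature $F'$ of $K'$ is computed with $\delta',m'$; $\delta,\delta^*$ on the right-hand side are those of $K$. For linear $J:C(X_k)\to C(X_k)$, $\operatorname{Tr}J=\sum_{x\in X_k}Jx(x)$. *)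

theory Defs
  imports "HOL-Analysis.Analysis"
begin

text \<open>
  For a finite subset \<open>A\<close> of a type, the space \<open>C(A) = \<real>\<^sup>A\<close> is represented by the real functions on
  the whole type that vanish outside \<open>A\<close>; so \<open>C(B)\<close> is literally a subspace of \<open>C(A)\<close> if
  \<open>B \<subseteq> A\<close>, and the cell \<open>x\<close>, seen as an element of \<open>C(A)\<close>, is \<open>indicator {x}\<close>.
\<close>

definition fun_space :: "'a set \<Rightarrow> ('a \<Rightarrow> real) set" where
  "fun_space A = {f. \<forall>x. x \<notin> A \<longrightarrow> f x = 0}"

text \<open>
  An operator on \<open>C(A)\<close> is a function on all of \<open>'a \<Rightarrow> real\<close>;
  its values outside \<open>C(A)\<close> are irrelevant.
\<close>

definition linear_operator :: "'a set \<Rightarrow> (('a \<Rightarrow> real) \<Rightarrow> 'a \<Rightarrow> real) \<Rightarrow> bool" where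
  "linear_operator A T \<longleftrightarrow>
     (\<forall>f\<in>fun_space A. T f \<in> fun_space A) \<and>
     (\<forall>f\<in>fun_space A. \<forall>g\<in>fun_space A. T (\<lambda>x. f x + g x) = (\<lambda>x. T f x + T g x)) \<and>
     (\<forall>c. \<forall>f\<in>fun_space A. T (\<lambda>x. c * f x) = (\<lambda>x. c * T f x))"

definition trace_on :: "'a set \<Rightarrow> (('a \<Rightarrow> real) \<Rightarrow> 'a \<Rightarrow> real) \<Rightarrow> real" where
  "trace_on A T = (\<Sum>x\<in>A. T (indicator {x}) x)"

text \<open>
  In \<open>K = (X, \<delta>, m)\<close> the set \<open>X\<close> is given by its graded pieces: \<open>cells K k\<close> is \<open>X\<^sub>k\<close>, and
  \<open>dim z = k\<close> is expressed as \<open>z \<in> cells K k\<close>.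
\<close>

record 'a complex_data =
  cells :: "nat \<Rightarrow> 'a set"
  cobd :: "('a \<Rightarrow> real) \<Rightarrow> 'a \<Rightarrow> real"
  weight :: "'a \<Rightarrow> real"

definition all_cells :: "'a complex_data \<Rightarrow> 'a set" where
  "all_cells K = (\<Union>k. cells K k)"

text \<open>\<open>covered K x z\<close> is the relation \<open>x \<lessdot> z\<close>.\<close>

definition covered :: "'a complex_data \<Rightarrow> 'a \<Rightarrow> 'a \<Rightarrow> bool" where
  "covered K x z \<longleftrightarrow> x \<in> all_cells K \<and> z \<in> all_cells K \<and> cobd K (indicator {x}) z \<noteq> 0"

locale cell_complex =
  fixes K :: "'a complex_data"
  assumes finite_cells: "finite (all_cells K)"
    and disjoint_cells: "i \<noteq> j \<Longrightarrow> cells K i \<inter> cells K j = {}"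
    and linear_cobd: "linear_operator (all_cells K) (cobd K)"
    and weight_pos: "x \<in> all_cells K \<Longrightarrow> weight K x > 0"
    and cobd_values: "\<lbrakk>v \<in> all_cells K; z \<in> all_cells K\<rbrakk> \<Longrightarrow> cobd K (indicator {v}) z \<in> {-1, 0, 1}"
    and cobd_degree:
      "\<lbrakk>v \<in> cells K i; z \<in> cells K j; j \<noteq> i + 1\<rbrakk> \<Longrightarrow> cobd K (indicator {v}) z = 0"
    and ex_face: "\<lbrakk>z \<in> cells K j; j \<ge> 1\<rbrakk> \<Longrightarrow> \<exists>x. covered K x z"
    and edge_endpoints:
      "x \<in> cells K 1 \<Longrightarrow>
         (\<exists>!w. w \<in> cells K 0 \<and> cobd K (indicator {w}) x = 1) \<and>
         (\<exists>!w. w \<in> cells K 0 \<and> cobd K (indicator {w}) x = -1)"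
    and diamond:
      "\<lbrakk>v \<in> cells K i; z \<in> cells K (i + 2); {x. covered K v x \<and> covered K x z} \<noteq> {}\<rbrakk> \<Longrightarrow>
         card {x. covered K v x \<and> covered K x z} = 2 \<and>
         {-1, 1} \<subseteq> {cobd K (indicator {v}) x * cobd K (indicator {x}) z | x. x \<in> all_cells K}"
    and boundary_connected:
      "\<lbrakk>z \<in> cells K j; j \<ge> 2; covered K x z; covered K y z\<rbrakk> \<Longrightarrow>
         \<exists>n p. p 0 = x \<and> p n = y \<and>
           (\<forall>i\<le>n. p i \<in> {u. covered K u z} \<union> {v. \<exists>u. covered K v u \<and> covered K u z}) \<and>
           (\<forall>i\<in>{1..n::nat}. cobd K (indicator {p i}) (p (i - 1))
                           + cobd K (indicator {p (i - 1)}) (p i) \<noteq> 0)"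
    and faces_determine:
      "\<lbrakk>z \<in> cells K j; j \<ge> 1; z' \<in> all_cells K; {x. covered K x z} = {x. covered K x z'}\<rbrakk>
         \<Longrightarrow> z = z'"

definition scalar_prod :: "'a complex_data \<Rightarrow> ('a \<Rightarrow> real) \<Rightarrow> ('a \<Rightarrow> real) \<Rightarrow> real" where
  "scalar_prod K f g = (\<Sum>x\<in>all_cells K. f x * g x * weight K x)"

definition norm1 :: "'a complex_data \<Rightarrow> ('a \<Rightarrow> real) \<Rightarrow> real" where
  "norm1 K f = (\<Sum>x\<in>all_cells K. weight K x * \<bar>f x\<bar>)"

text \<open>
  The adjoint of \<open>\<delta>\<close>, specified by its defining identity; the lemma \<open>coadj_eq\<close> below shows that
  the function described here exists and is unique.
\<close>

definition coadj :: "'a complex_data \<Rightarrow> ('a \<Rightarrow> real) \<Rightarrow> 'a \<Rightarrow> real" where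
  "coadj K f = (THE g. g \<in> fun_space (all_cells K) \<and>
     (\<forall>h\<in>fun_space (all_cells K). scalar_prod K (cobd K h) f = scalar_prod K h g))"

definition hodge :: "'a complex_data \<Rightarrow> ('a \<Rightarrow> real) \<Rightarrow> 'a \<Rightarrow> real" where
  "hodge K f = (\<lambda>x. cobd K (coadj K f) x + coadj K (cobd K f) x)"

definition forman :: "'a complex_data \<Rightarrow> 'a \<Rightarrow> real" where
  "forman K x = hodge K (indicator {x}) x
     - (\<Sum>y\<in>all_cells K - {x}. \<bar>hodge K (indicator {y}) x\<bar>)"

definition subcomplex_le :: "nat \<Rightarrow> 'a complex_data \<Rightarrow> 'a complex_data \<Rightarrow> bool" where
  "subcomplex_le k K' K \<longleftrightarrow>
     (\<forall>j\<le>k. cells K' j = cells K j) \<and>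
     (\<forall>j>k. cells K' j \<subseteq> cells K j) \<and>
     (\<forall>j\<le>k. \<forall>x\<in>cells K j. weight K x = weight K' x) \<and>
     (\<forall>v\<in>all_cells K'. \<forall>x\<in>all_cells K'. cobd K' (indicator {v}) x = cobd K (indicator {v}) x)"

text \<open>Unlike \<open>Max\<close> and \<open>Sup\<close>, these assert that the extremum exists and is attained.\<close>

definition is_maximum :: "real set \<Rightarrow> real \<Rightarrow> bool" where
  "is_maximum S c \<longleftrightarrow> c \<in> S \<and> (\<forall>s\<in>S. s \<le> c)"

definition is_minimum :: "real set \<Rightarrow> real \<Rightarrow> bool" where
  "is_minimum S c \<longleftrightarrow> c \<in> S \<and> (\<forall>s\<in>S. c \<le> s)"

lemma indicator_in_fun_space: "x \<in> A \<Longrightarrow> indicator {x} \<in> fun_space A"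
  by (auto simp: fun_space_def indicator_def)

lemma linear_operator_add:
  "\<lbrakk>linear_operator A T; f \<in> fun_space A; g \<in> fun_space A\<rbrakk>
     \<Longrightarrow> T (\<lambda>x. f x + g x) = (\<lambda>x. T f x + T g x)"
  unfolding linear_operator_def by meson

lemma linear_operator_scale:
  "\<lbrakk>linear_operator A T; f \<in> fun_space A\<rbrakk> \<Longrightarrow> T (\<lambda>x. c * f x) = (\<lambda>x. c * T f x)"
  unfolding linear_operator_def by meson

lemma linear_operator_expand:
  assumes T: "linear_operator A T" and A: "finite A" and h: "h \<in> fun_space A"
  shows "T h x = (\<Sum>v\<in>A. h v * T (indicator {v}) x)"
proof -
  have *: "(\<lambda>y. \<Sum>v\<in>B. h v * indicator {v} y) \<in> fun_space A \<and>
        T (\<lambda>y. \<Sum>v\<in>B. h v * indicator {v} y) = (\<lambda>x. \<Sum>v\<in>B. h v * T (indicator {v}) x)"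
    if "finite B" "B \<subseteq> A" for B
    using that
  proof (induction B rule: finite_induct)
    case empty
    have z: "(\<lambda>x. 0) \<in> fun_space A" by (simp add: fun_space_def)
    have "T (\<lambda>x. 0 * (0::real)) = (\<lambda>x. 0 * T (\<lambda>x. 0) x)"
      by (rule linear_operator_scale[OF T z])
    then show ?case using z by simp
  next
    case (insert b B)
    let ?s = "\<lambda>y. \<Sum>v\<in>B. h v * indicator {v} y"
    have s: "?s \<in> fun_space A" "T ?s = (\<lambda>x. \<Sum>v\<in>B. h v * T (indicator {v}) x)"
      using insert by auto
    have i: "indicator {b} \<in> fun_space A"
      using insert by (intro indicator_in_fun_space) auto
    have c: "(\<lambda>y. h b * indicator {b} y) \<in> fun_space A"
      using i by (simp add: fun_space_def)
    have Tc: "T (\<lambda>y. h b * indicator {b} y) = (\<lambda>x. h b * T (indicator {b}) x)"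
      by (rule linear_operator_scale[OF T i])
    have Ts: "T (\<lambda>y. h b * indicator {b} y + ?s y)
        = (\<lambda>x. T (\<lambda>y. h b * indicator {b} y) x + T ?s x)"
      by (rule linear_operator_add[OF T c s(1)])
    have e: "(\<lambda>y. \<Sum>v\<in>insert b B. h v * indicator {v} y)
        = (\<lambda>y. h b * indicator {b} y + ?s y)"
      by (simp only: sum.insert[OF insert.hyps])
    have m: "(\<lambda>y. h b * indicator {b} y + ?s y) \<in> fun_space A"
      using c s(1) by (simp add: fun_space_def)
    have "T (\<lambda>y. h b * indicator {b} y + ?s y)
        = (\<lambda>x. \<Sum>v\<in>insert b B. h v * T (indicator {v}) x)"
      unfolding Ts Tc s(2) by (simp only: sum.insert[OF insert.hyps])
    then show ?case unfolding e using m by blast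
  qed
  have "h = (\<lambda>y. \<Sum>v\<in>A. h v * indicator {v} y)"
  proof
    fix y
    have "(\<Sum>v\<in>A. h v * indicator {v} y) = (\<Sum>v\<in>A. if v = y then h y else 0)"
      by (rule sum.cong) (auto simp: indicator_def)
    also have "\<dots> = h y" using A h by (auto simp: fun_space_def sum.delta)
    finally show "h y = (\<Sum>v\<in>A. h v * indicator {v} y)" by simp
  qed
  then show ?thesis using *[OF A] by (metis subset_refl)
qed

lemma (in cell_complex) coadj_eq:
  "coadj K f = (\<lambda>v. if v \<in> all_cells K then
     (\<Sum>x\<in>all_cells K. weight K x / weight K v * cobd K (indicator {v}) x * f x) else 0)"
  (is "_ = ?g")
  unfolding coadj_def
proof (rule the_equality)
  show "?g \<in> fun_space (all_cells K) \<and>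
    (\<forall>h\<in>fun_space (all_cells K). scalar_prod K (cobd K h) f = scalar_prod K h ?g)"
  proof (intro conjI ballI)
    fix h :: "'a \<Rightarrow> real" assume h: "h \<in> fun_space (all_cells K)"
    have "scalar_prod K (cobd K h) f
        = (\<Sum>x\<in>all_cells K. \<Sum>v\<in>all_cells K. h v * cobd K (indicator {v}) x * f x * weight K x)"
      unfolding scalar_prod_def linear_operator_expand[OF linear_cobd finite_cells h]
      by (simp add: sum_distrib_right)
    also have "\<dots> = (\<Sum>v\<in>all_cells K. \<Sum>x\<in>all_cells K.
        h v * cobd K (indicator {v}) x * f x * weight K x)"
      by (rule sum.swap)
    also have "\<dots> = scalar_prod K h ?g"
      unfolding scalar_prod_def
    proof (rule sum.cong[OF refl])
      fix v assume v: "v \<in> all_cells K"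
      have "weight K v \<noteq> 0" using weight_pos[OF v] by simp
      then show "(\<Sum>x\<in>all_cells K. h v * cobd K (indicator {v}) x * f x * weight K x)
          = h v * ?g v * weight K v"
        using v by (simp add: sum_distrib_left sum_distrib_right mult_ac)
    qed
    finally show "scalar_prod K (cobd K h) f = scalar_prod K h ?g" .
  qed (simp add: fun_space_def)
  fix g assume g: "g \<in> fun_space (all_cells K) \<and>
    (\<forall>h\<in>fun_space (all_cells K). scalar_prod K (cobd K h) f = scalar_prod K h g)"
  have sp: "scalar_prod K (indicator {v}) u = u v * weight K v" if "v \<in> all_cells K" for u v
  proof -
    have "scalar_prod K (indicator {v}) u
        = (\<Sum>x\<in>all_cells K. if x = v then u v * weight K v else 0)"
      unfolding scalar_prod_def by (intro sum.cong) (auto simp: indicator_def)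
    then show ?thesis using that finite_cells by simp
  qed
  show "g = ?g"
  proof
    fix v show "g v = ?g v"
    proof (cases "v \<in> all_cells K")
      case True
      have "g v * weight K v = scalar_prod K (cobd K (indicator {v})) f"
        using g sp[OF True] indicator_in_fun_space[OF True] by metis
      then show ?thesis using True weight_pos[OF True]
        by (simp add: scalar_prod_def field_simps flip: sum_divide_distrib)
    qed (use g in \<open>simp add: fun_space_def\<close>)
  qed
qed

end

theory Submission
  imports Defs
begin

text \<open>
  On \<open>X\<^sub>k\<close> the Hodge Laplacian of a subcomplex has the matrix \<open>A + (\<Sum>z. w z * B\<^sub>z)\<close>, where \<open>A\<close> is the
  matrix of \<open>\<delta>\<delta>\<^sup>*\<close> and does not change, and \<open>w z \<ge> 0\<close> is the new weight of the cell \<open>z \<in> X\<^bsub>k+1\<^esub>\<close>, with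
  \<open>w z = 0\<close> if \<open>z\<close> has been removed; every such \<open>w\<close> occurs, since all cells above dimension \<open>k + 1\<close>
  may be dropped. The minimal Forman curvature is the minimum of the linear forms \<open>\<langle>P, \<cdot>\<rangle>\<close> over the
  matrices \<open>P\<close> of trace one whose diagonal dominates the rows, and these are the operators \<open>J\<close> with (a) and
  (c) under \<open>P x y = Jy(x) m(x) / m(y)\<close>. The theorem is then linear programming duality, (b)
  being the dual constraint \<open>\<langle>P, B\<^sub>z\<rangle> \<le> 0\<close>. The dual problem is feasible because every cell of
  dimension \<open>k + 1\<close> containing \<open>x\<close> has a second face whose orientation relative to \<open>x\<close> is
  independent of the cell.
\<close>

subsection \<open>Duality for diagonally dominated matrices\<close>

lemma ex_between_finite:
  fixes A B :: "real set"
  assumes "finite A" "finite B" "\<And>a b. a \<in> A \<Longrightarrow> b \<in> B \<Longrightarrow> a \<le> b"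
  obtains t where "\<And>a. a \<in> A \<Longrightarrow> a \<le> t" "\<And>b. b \<in> B \<Longrightarrow> t \<le> b"
proof (cases "A = {}")
  case True
  with assms(2) show ?thesis
    by (intro that[of "if B = {} then 0 else Min B"]) auto
next
  case False
  with assms show ?thesis
    by (intro that[of "Max A"]) auto
qed

text \<open>Stating the alternative for an arbitrary convex cone \<open>C\<close> containing the constraints, rather
  than for their nonnegative combinations, lets Fourier-Motzkin elimination pass to the subcone of
  \<open>C\<close> on which the eliminated coefficient vanishes.\<close>

lemma farkas_cone:
  fixes C :: "(real \<times> ('b \<Rightarrow> real)) set"
  assumes "finite Z" "finite S" "S \<subseteq> C"
    and "\<And>r d g. r \<ge> 0 \<Longrightarrow> (d, g) \<in> C \<Longrightarrow> (r * d, \<lambda>z. r * g z) \<in> C"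
    and "\<And>d g d' g'. (d, g) \<in> C \<Longrightarrow> (d', g') \<in> C \<Longrightarrow> (d + d', \<lambda>z. g z + g' z) \<in> C"
    and "\<And>d g. (d, g) \<in> C \<Longrightarrow> (\<And>z. z \<in> Z \<Longrightarrow> g z = 0) \<Longrightarrow> d \<ge> 0"
  shows "\<exists>w. \<forall>(d, g)\<in>S. d + (\<Sum>z\<in>Z. w z * g z) \<ge> 0"
  using assms
proof (induction Z arbitrary: S C rule: finite_induct)
  case empty
  have "d \<ge> 0" if "(d, g) \<in> S" for d g
    using empty.prems(2,5) that by blast
  then show ?case by auto
next
  case (insert z Z)
  note scale = insert.prems(3) and plus = insert.prems(4)
  define pos where "pos = {s \<in> S. snd s z > 0}"
  define neg where "neg = {s \<in> S. snd s z < 0}"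
  \<comment> \<open>For \<open>p\<close> in \<open>pos\<close> and \<open>n\<close> in
    \<open>neg\<close> both multipliers are positive, and they are chosen so that the coefficients
    at \<open>z\<close> cancel.\<close>
  define comb where "comb = (\<lambda>(p :: real \<times> ('b \<Rightarrow> real), n :: real \<times> ('b \<Rightarrow> real)).
     (- snd n z * fst p + snd p z * fst n, \<lambda>u. - snd n z * snd p u + snd p z * snd n u))"
  define S' where "S' = {s \<in> S. snd s z = 0} \<union> comb ` (pos \<times> neg)"
  define C' where "C' = {s \<in> C. snd s z = 0}"
  have fin: "finite pos" "finite neg" "finite S'"
    using insert.prems(1) by (auto simp: pos_def neg_def S'_def)
  have "comb (p, n) \<in> C'" if "p \<in> pos" "n \<in> neg" for p n
  proof -
    have pn: "(fst p, snd p) \<in> C" "(fst n, snd n) \<in> C" "snd p z > 0" "snd n z < 0"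
      using that insert.prems(2) by (auto simp: pos_def neg_def)
    have "(- snd n z * fst p, \<lambda>u. - snd n z * snd p u) \<in> C"
      by (rule scale) (use pn in auto)
    moreover have "(snd p z * fst n, \<lambda>u. snd p z * snd n u) \<in> C"
      by (rule scale) (use pn in auto)
    ultimately have "(- snd n z * fst p + snd p z * fst n,
        \<lambda>u. - snd n z * snd p u + snd p z * snd n u) \<in> C"
      by (rule plus)
    then show ?thesis by (simp add: comb_def C'_def)
  qed
  then have sub: "S' \<subseteq> C'"
    using insert.prems(2) unfolding S'_def by (auto simp: C'_def)
  have "\<exists>w. \<forall>(d, g)\<in>S'. d + (\<Sum>z\<in>Z. w z * g z) \<ge> 0"
  proof (rule insert.IH[OF fin(3) sub])
    show "(r * d, \<lambda>z. r * g z) \<in> C'" if "r \<ge> 0" "(d, g) \<in> C'" for r d g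
      using that scale by (simp add: C'_def)
    show "(d + d', \<lambda>z. g z + g' z) \<in> C'" if "(d, g) \<in> C'" "(d', g') \<in> C'" for d g d' g'
      using that plus by (simp add: C'_def)
    \<comment> \<open>On \<open>C'\<close> the coefficient at \<open>z\<close> is zero already, so
      vanishing on \<open>Z\<close> means vanishing on \<open>insert z Z\<close>.\<close>
    show "d \<ge> 0" if "(d, g) \<in> C'" "\<And>u. u \<in> Z \<Longrightarrow> g u = 0" for d g
      using that insert.prems(5)[of d g] by (auto simp: C'_def)
  qed
  then obtain w where w: "\<And>d g. (d, g) \<in> S' \<Longrightarrow> d + (\<Sum>z\<in>Z. w z * g z) \<ge> 0"
    by blast
  define val where "val = (\<lambda>s :: real \<times> ('b \<Rightarrow> real). fst s + (\<Sum>z\<in>Z. w z * snd s z))"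
  have val: "val s \<ge> 0" if "s \<in> S'" for s
    using w[of "fst s" "snd s"] that by (simp add: val_def)
  have val_comb: "val (comb (p, n)) = - snd n z * val p + snd p z * val n" for p n
    by (simp add: val_def comb_def algebra_simps sum.distrib sum_negf sum_subtractf sum_distrib_left mult.left_commute)
  \<comment> \<open>Each \<open>p\<close> bounds the value of the variable \<open>z\<close> from
    below and each \<open>n\<close> from above; nonnegativity of \<open>val (comb (p, n))\<close> is
    the compatibility of these two bounds.\<close>
  have le: "- val p / snd p z \<le> - val n / snd n z" if "p \<in> pos" "n \<in> neg" for p n
  proof -
    have "val (comb (p, n)) \<ge> 0"
      using that by (intro val) (auto simp: S'_def)
    moreover have "snd p z > 0" "snd n z < 0"
      using that by (auto simp: pos_def neg_def)
    ultimately show ?thesis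
      by (simp add: val_comb field_simps)
  qed
  obtain t where t: "\<And>a. a \<in> (\<lambda>p. - val p / snd p z) ` pos \<Longrightarrow> a \<le> t"
      "\<And>b. b \<in> (\<lambda>n. - val n / snd n z) ` neg \<Longrightarrow> t \<le> b"
    by (rule ex_between_finite[of "(\<lambda>p. - val p / snd p z) ` pos" "(\<lambda>n. - val n / snd n z) ` neg"])
      (use fin le in auto)
  have ok: "val s + t * snd s z \<ge> 0" if "s \<in> S" for s
  proof (cases "snd s z" "0 :: real" rule: linorder_cases)
    case less
    then have "t \<le> - val s / snd s z"
      using that by (intro t) (auto simp: neg_def)
    with less show ?thesis by (simp add: field_simps)
  next
    case equal
    with that val show ?thesis by (simp add: S'_def)
  next
    case greater
    then have "- val s / snd s z \<le> t"
      using that by (intro t) (auto simp: pos_def)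
    with greater show ?thesis by (simp add: field_simps)
  qed
  have "(\<Sum>u\<in>insert z Z. (w(z := t)) u * g u) = t * g z + (\<Sum>u\<in>Z. w u * g u)" for g
    using insert.hyps by (simp add: sum.insert_if) (auto intro!: sum.cong)
  then have "\<forall>(d, g)\<in>S. d + (\<Sum>u\<in>insert z Z. (w(z := t)) u * g u) \<ge> 0"
    using ok by (auto simp: val_def algebra_simps)
  then show ?case by blast
qed

section \<open>Row gaps as minima of linear forms over dominated matrices\<close>

definition dominated :: "'a set \<Rightarrow> ('a \<Rightarrow> 'a \<Rightarrow> real) \<Rightarrow> bool" where
  "dominated N P \<longleftrightarrow> (\<forall>x\<in>N. \<forall>y\<in>N. \<bar>P x y\<bar> \<le> P x x)"

definition pairing :: "'a set \<Rightarrow> ('a \<Rightarrow> 'a \<Rightarrow> real) \<Rightarrow> ('a \<Rightarrow> 'a \<Rightarrow> real) \<Rightarrow> real" where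
  "pairing N P M = (\<Sum>x\<in>N. \<Sum>y\<in>N. P x y * M x y)"

text \<open>The left end of the Gershgorin interval of row \<open>x\<close>; for the matrix of
  \<open>H\<close> it is the Forman curvature.\<close>

definition row_gap :: "'a set \<Rightarrow> ('a \<Rightarrow> 'a \<Rightarrow> real) \<Rightarrow> 'a \<Rightarrow> real" where
  "row_gap N M x = M x x - (\<Sum>y\<in>N - {x}. \<bar>M x y\<bar>)"

lemma row_gap_cong:
  assumes "x \<in> N" "\<And>y. y \<in> N \<Longrightarrow> M x y = M' x y"
  shows "row_gap N M x = row_gap N M' x"
  using assms by (simp add: row_gap_def)

lemma pairing_scale: "pairing N (\<lambda>x y. r * P x y) M = r * pairing N P M"
  by (simp add: pairing_def sum_distrib_left mult_ac)

lemma pairing_plus: "pairing N (\<lambda>x y. P x y + Q x y) M = pairing N P M + pairing N Q M"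
  by (simp add: pairing_def sum.distrib algebra_simps)

lemma pairing_plus_right: "pairing N P (\<lambda>x y. M x y + L x y) = pairing N P M + pairing N P L"
  by (simp add: pairing_def sum.distrib algebra_simps)

lemma pairing_sum_right:
  "pairing N P (\<lambda>x y. \<Sum>z\<in>Z. w z * B z x y) = (\<Sum>z\<in>Z. w z * pairing N P (B z))"
proof (induction Z rule: infinite_finite_induct)
  case (insert z Z)
  have "pairing N P (\<lambda>x y. w z * B z x y) = w z * pairing N P (B z)"
    by (simp add: pairing_def sum_distrib_left mult_ac)
  then show ?case using insert by (simp add: pairing_plus_right)
qed (auto simp: pairing_def)

text \<open>A nonnegative diagonal with zero sum vanishes, and domination then kills every other
  entry over \<open>N\<close>. This covers the matrices that cannot be scaled to trace one.\<close>

lemma pairing_eq_0: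
  assumes "finite N" "dominated N P" "(\<Sum>x\<in>N. P x x) = 0"
  shows "pairing N P M = 0"
proof -
  have "P x x = 0" if "x \<in> N" for x
  proof -
    have "\<forall>x\<in>N. P x x = 0"
      using assms by (subst (asm) sum_nonneg_eq_0_iff) (force simp: dominated_def)+
    with that show ?thesis by blast
  qed
  with assms(2) have "P x y = 0" if "x \<in> N" "y \<in> N" for x y
    using that by (fastforce simp: dominated_def)
  then show ?thesis by (simp add: pairing_def)
qed

text \<open>Off the diagonal, domination gives \<open>P x y * M x y \<ge> - P x x * |M x y|\<close>;
  sum over each row.\<close>

lemma row_gap_le_pairing:
  assumes "finite N" "dominated N P"
  shows "(\<Sum>x\<in>N. P x x * row_gap N M x) \<le> pairing N P M"
  unfolding pairing_def
proof (rule sum_mono)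
  fix x assume x: "x \<in> N"
  have "(\<Sum>y\<in>N - {x}. P x x * - \<bar>M x y\<bar>) \<le> (\<Sum>y\<in>N - {x}. P x y * M x y)"
  proof (rule sum_mono)
    fix y assume "y \<in> N - {x}"
    then have "\<bar>P x y * M x y\<bar> \<le> P x x * \<bar>M x y\<bar>"
      using assms x by (auto simp: dominated_def abs_mult intro: mult_right_mono)
    then show "P x x * - \<bar>M x y\<bar> \<le> P x y * M x y" by linarith
  qed
  then show "P x x * row_gap N M x \<le> (\<Sum>y\<in>N. P x y * M x y)"
    using x assms(1)
    by (simp add: row_gap_def sum.remove[of N x] right_diff_distrib sum_distrib_left sum_negf)
qed

text \<open>The core of weak duality: the diagonal of \<open>P\<close> supplies the weights of a
  convex combination of the row gaps.\<close>

lemma row_gap_bound_le_pairing: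
  assumes "finite N" "dominated N P" "(\<Sum>x\<in>N. P x x) = 1"
    and "\<And>x. x \<in> N \<Longrightarrow> t \<le> row_gap N M x"
  shows "t \<le> pairing N P M"
proof -
  have "t = (\<Sum>x\<in>N. P x x * t)"
    using assms(3) by (simp flip: sum_distrib_right)
  also have "\<dots> \<le> (\<Sum>x\<in>N. P x x * row_gap N M x)"
    using assms by (intro sum_mono mult_left_mono) (auto simp: dominated_def intro: order_trans[OF abs_ge_zero])
  also have "\<dots> \<le> pairing N P M"
    by (rule row_gap_le_pairing) fact+
  finally show ?thesis .
qed

text \<open>These are the extreme points of the dominated matrices of trace one.\<close>

definition sign_row :: "'a \<Rightarrow> 'a set \<Rightarrow> 'a \<Rightarrow> 'a \<Rightarrow> real" where
  "sign_row x E = (\<lambda>u v. if u = x then if v = x \<or> v \<in> E then 1 else - 1 else 0)"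

lemma dominated_sign_row: "dominated N (sign_row x E)"
  by (auto simp: dominated_def sign_row_def)

lemma trace_sign_row: "finite N \<Longrightarrow> x \<in> N \<Longrightarrow> (\<Sum>u\<in>N. sign_row x E u u) = 1"
  by (simp add: sign_row_def)

text \<open>Off-diagonal signs opposite to those of \<open>M\<close> turn the estimate of
  \<open>row_gap_le_pairing\<close> into an equality. A row gap is thus the least of finitely many
  linear forms in \<open>M\<close>.\<close>

lemma pairing_sign_row:
  assumes "finite N" "x \<in> N"
  shows "pairing N (sign_row x {y \<in> N. M x y \<le> 0}) M = row_gap N M x"
proof -
  let ?E = "{y \<in> N. M x y \<le> 0}"
  have "pairing N (sign_row x ?E) M = (\<Sum>u\<in>N. if u = x then \<Sum>y\<in>N. sign_row x ?E x y * M x y else 0)"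
    unfolding pairing_def by (intro sum.cong) (auto simp: sign_row_def)
  also have "\<dots> = (\<Sum>y\<in>N. sign_row x ?E x y * M x y)"
    using assms by simp
  also have "\<dots> = M x x + (\<Sum>y\<in>N - {x}. sign_row x ?E x y * M x y)"
    using assms by (simp add: sum.remove[of N x] sign_row_def)
  also have "(\<Sum>y\<in>N - {x}. sign_row x ?E x y * M x y) = (\<Sum>y\<in>N - {x}. - \<bar>M x y\<bar>)"
    by (intro sum.cong) (auto simp: sign_row_def)
  finally show ?thesis by (simp add: row_gap_def sum_negf)
qed

text \<open>Domination and trace one bound every entry over \<open>N\<close> by one in absolute
  value, so a minimiser exists by compactness.\<close>

lemma pairing_minimum_attained:
  fixes P0 :: "'a \<Rightarrow> 'a \<Rightarrow> real" and B :: "'b \<Rightarrow> 'a \<Rightarrow> 'a \<Rightarrow> real"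
  assumes N: "finite N"
    and "dominated N P0" "(\<Sum>x\<in>N. P0 x x) = 1" "\<And>z. z \<in> Z \<Longrightarrow> pairing N P0 (B z) \<le> 0"
  obtains P where "dominated N P" "(\<Sum>x\<in>N. P x x) = 1" "\<And>z. z \<in> Z \<Longrightarrow> pairing N P (B z) \<le> 0"
    "\<forall>Q. dominated N Q \<and> (\<Sum>x\<in>N. Q x x) = 1 \<and> (\<forall>z\<in>Z. pairing N Q (B z) \<le> 0)
       \<longrightarrow> pairing N P A \<le> pairing N Q A"
proof -
  define feasible where "feasible = (\<lambda>P. dominated N P \<and> (\<Sum>x\<in>N. P x x) = 1 \<and>
    (\<forall>z\<in>Z. pairing N P (B z) \<le> 0))"
  \<comment> \<open>The cube ranges over all pairs of the type and is compact by Tychonoff even if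
    the type is infinite. Feasibility is a closed condition on it.\<close>
  define box where "box = (\<Pi>\<^sub>E p\<in>UNIV. {-1..1 :: real}) \<inter> {p :: 'a \<times> 'a \<Rightarrow> real. feasible (curry p)}"
  have cont [continuous_intros]: "continuous_on UNIV (\<lambda>p :: 'a \<times> 'a \<Rightarrow> real. p i)" for i
    by (rule continuous_on_product_coordinates)
  have "compact (\<Pi>\<^sub>E p\<in>(UNIV :: ('a \<times> 'a) set). {-1..1 :: real})"
    using compactin_PiE[of "\<lambda>_. euclidean :: real topology" UNIV "\<lambda>_. {-1..1}"]
    by (simp add: euclidean_product_topology)
  moreover have "closed {p :: 'a \<times> 'a \<Rightarrow> real. feasible (curry p)}"
    unfolding feasible_def dominated_def pairing_def curry_def Ball_def
    by (intro closed_Collect_conj closed_Collect_all closed_Collect_imp closed_Collect_le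
        closed_Collect_eq open_Collect_const continuous_intros)
  ultimately have comp: "compact box"
    unfolding box_def by (rule compact_Int_closed)
  \<comment> \<open>Entries outside \<open>N\<close> affect neither feasibility nor the pairing;
    they are reset to zero so that the matrix fits into the cube.\<close>
  define trunc where "trunc = (\<lambda>Q (x :: 'a, y :: 'a). if x \<in> N \<and> y \<in> N then Q x y else (0 :: real))"
  have pairing_trunc: "pairing N (curry (trunc Q)) M = pairing N Q M" for Q M
    by (simp add: trunc_def pairing_def)
  have trunc: "trunc Q \<in> box" if "feasible Q" for Q
  proof -
    have "\<bar>Q x y\<bar> \<le> 1" if "x \<in> N" "y \<in> N" for x y
    proof -
      have "\<bar>Q x y\<bar> \<le> Q x x"
        using \<open>feasible Q\<close> that by (auto simp: feasible_def dominated_def)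
      also have "\<dots> \<le> (\<Sum>x\<in>N. Q x x)"
        using \<open>feasible Q\<close> that N
        by (intro member_le_sum) (auto simp: feasible_def dominated_def intro: order_trans[OF abs_ge_zero])
      finally show ?thesis using \<open>feasible Q\<close> by (simp add: feasible_def)
    qed
    then have "\<bar>trunc Q p\<bar> \<le> 1" for p
      by (simp add: trunc_def split: prod.split)
    then have "trunc Q p \<in> {-1..1}" for p
      by (simp add: abs_le_iff minus_le_iff)
    moreover have "feasible (curry (trunc Q))"
      using that unfolding feasible_def pairing_trunc by (auto simp: trunc_def dominated_def)
    ultimately show ?thesis by (auto simp: box_def)
  qed
  have "feasible P0" using assms by (simp add: feasible_def)
  then have ne: "box \<noteq> {}" using trunc by blast
  have "continuous_on box (\<lambda>p. pairing N (curry p) A)"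
    unfolding pairing_def curry_def
    by (intro continuous_intros continuous_on_subset[OF cont]) auto
  from continuous_attains_inf[OF comp ne this] obtain p where p: "p \<in> box"
    "\<And>q. q \<in> box \<Longrightarrow> pairing N (curry p) A \<le> pairing N (curry q) A" by blast
  show ?thesis
  proof (rule that[of "curry p"])
    show "\<forall>Q. dominated N Q \<and> (\<Sum>x\<in>N. Q x x) = 1 \<and> (\<forall>z\<in>Z. pairing N Q (B z) \<le> 0)
        \<longrightarrow> pairing N (curry p) A \<le> pairing N Q A"
      using p(2)[OF trunc] by (simp add: feasible_def pairing_trunc)
  qed (use p(1) in \<open>auto simp: box_def feasible_def\<close>)
qed

text \<open>Strong duality, with \<open>P\<close> a minimiser. That every row gap is at least the
  minimum is a finite system of linear inequalities in \<open>w\<close>, one for each sign row, and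
  minimality of \<open>P\<close> rules out its inconsistency.\<close>

lemma row_gap_duality:
  fixes P0 :: "'a \<Rightarrow> 'a \<Rightarrow> real" and B :: "'b \<Rightarrow> 'a \<Rightarrow> 'a \<Rightarrow> real"
  assumes N: "finite N" and Z: "finite Z"
    and P0: "dominated N P0" "(\<Sum>x\<in>N. P0 x x) = 1" "\<And>z. z \<in> Z \<Longrightarrow> pairing N P0 (B z) \<le> 0"
  obtains P w where "dominated N P" "(\<Sum>x\<in>N. P x x) = 1" "\<forall>z\<in>Z. pairing N P (B z) \<le> 0"
    "\<forall>z\<in>Z. w z \<ge> 0"
    "\<forall>x\<in>N. pairing N P A \<le> row_gap N (\<lambda>x y. A x y + (\<Sum>z\<in>Z. w z * B z x y)) x"
proof -
  obtain P where P: "dominated N P" "(\<Sum>x\<in>N. P x x) = 1" "\<forall>z\<in>Z. pairing N P (B z) \<le> 0"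
    and min: "\<forall>Q. dominated N Q \<and> (\<Sum>x\<in>N. Q x x) = 1 \<and> (\<forall>z\<in>Z. pairing N Q (B z) \<le> 0)
       \<longrightarrow> pairing N P A \<le> pairing N Q A"
    by (rule pairing_minimum_attained[OF N P0, where A = A]) blast+
  define c where "c = pairing N P A"
  \<comment> \<open>Subtracting \<open>c\<close> times the trace makes the comparison with the
    minimum homogeneous, so that it can be stated on a cone.\<close>
  define obj where "obj = (\<lambda>Q. pairing N Q A - c * (\<Sum>x\<in>N. Q x x))"
  \<comment> \<open>Letting \<open>g\<close> exceed the pairings makes room in \<open>C\<close> for
    the constraints \<open>w z \<ge> 0\<close>, which are obtained from
    \<open>Q = 0\<close>.\<close>
  define C where "C = {(d, g). \<exists>Q. dominated N Q \<and> d = obj Q \<and> (\<forall>z\<in>Z. pairing N Q (B z) \<le> g z)}"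
  \<comment> \<open>The first family says that all row gaps are at least \<open>c\<close>, by
    \<open>pairing_sign_row\<close>; the second says that \<open>w\<close> is nonnegative on
    \<open>Z\<close>.\<close>
  define S where "S = (\<lambda>(x, E). (obj (sign_row x E), \<lambda>z. pairing N (sign_row x E) (B z))) ` (N \<times> Pow N)
     \<union> (\<lambda>z. (0, indicator {z})) ` Z"
  have "\<exists>w. \<forall>(d, g)\<in>S. d + (\<Sum>z\<in>Z. w z * g z) \<ge> 0"
  proof (rule farkas_cone[where C = C])
    show "finite Z" "finite S" using N Z by (auto simp: S_def)
    have "(0, indicator {z}) \<in> C" for z
      unfolding C_def by (auto intro!: exI[of _ "\<lambda>_ _. 0"] simp: dominated_def obj_def pairing_def)
    moreover have "(obj (sign_row x E), \<lambda>z. pairing N (sign_row x E) (B z)) \<in> C" for x E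
      unfolding C_def using dominated_sign_row[of N x E] by auto
    ultimately show "S \<subseteq> C" by (auto simp: S_def)
    show "(r * d, \<lambda>z. r * g z) \<in> C" if "r \<ge> 0" "(d, g) \<in> C" for r d g
    proof -
      obtain Q where Q: "dominated N Q" "d = obj Q" "\<forall>z\<in>Z. pairing N Q (B z) \<le> g z"
        using \<open>(d, g) \<in> C\<close> by (auto simp: C_def)
      have "dominated N (\<lambda>x y. r * Q x y)"
        using Q(1) \<open>r \<ge> 0\<close> by (auto simp: dominated_def abs_mult intro: mult_left_mono)
      moreover have "obj (\<lambda>x y. r * Q x y) = r * obj Q"
        by (simp add: obj_def pairing_scale sum_distrib_left algebra_simps)
      ultimately show ?thesis
        using Q \<open>r \<ge> 0\<close> unfolding C_def
        by (auto intro!: exI[of _ "\<lambda>x y. r * Q x y"] mult_left_mono simp: pairing_scale)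
    qed
    show "(d + d', \<lambda>z. g z + g' z) \<in> C" if "(d, g) \<in> C" "(d', g') \<in> C" for d g d' g'
    proof -
      obtain Q where Q: "dominated N Q" "d = obj Q" "\<forall>z\<in>Z. pairing N Q (B z) \<le> g z"
        using \<open>(d, g) \<in> C\<close> by (auto simp: C_def)
      obtain Q' where Q': "dominated N Q'" "d' = obj Q'" "\<forall>z\<in>Z. pairing N Q' (B z) \<le> g' z"
        using \<open>(d', g') \<in> C\<close> by (auto simp: C_def)
      have "dominated N (\<lambda>x y. Q x y + Q' x y)"
        using Q(1) Q'(1) unfolding dominated_def
        by (meson abs_triangle_ineq add_mono order_trans)
      moreover have "obj (\<lambda>x y. Q x y + Q' x y) = obj Q + obj Q'"
        by (simp add: obj_def pairing_plus sum.distrib algebra_simps)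
      ultimately show ?thesis
        using Q Q' unfolding C_def
        by (auto intro!: exI[of _ "\<lambda>x y. Q x y + Q' x y"] add_mono simp: pairing_plus)
    qed
    show "d \<ge> 0" if dg: "(d, g) \<in> C" "\<And>z. z \<in> Z \<Longrightarrow> g z = 0" for d g
    proof -
      obtain Q where Q: "dominated N Q" "d = obj Q" "\<And>z. z \<in> Z \<Longrightarrow> pairing N Q (B z) \<le> 0"
        using dg by (fastforce simp: C_def)
      define s where "s = (\<Sum>x\<in>N. Q x x)"
      have "s \<ge> 0"
        unfolding s_def using Q(1)
        by (intro sum_nonneg) (auto simp: dominated_def intro: order_trans[OF abs_ge_zero])
      show ?thesis
      proof (cases "s = 0")
        case True
        then show ?thesis
          using pairing_eq_0[OF N Q(1)] by (simp add: Q(2) obj_def flip: s_def)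
      next
        case False
        with \<open>s \<ge> 0\<close> have s: "s > 0" by simp
        \<comment> \<open>Scaled to trace one, \<open>Q\<close> becomes a competitor of
          \<open>P\<close>.\<close>
        let ?R = "\<lambda>x y. (1 / s) * Q x y"
        have "pairing N P A \<le> pairing N ?R A"
        proof (rule min[rule_format], intro conjI ballI)
          show "dominated N ?R"
            using Q(1) s by (auto simp: dominated_def abs_mult divide_right_mono)
          show "(\<Sum>x\<in>N. ?R x x) = 1"
            using s by (simp add: s_def flip: sum_divide_distrib)
          show "pairing N ?R (B z) \<le> 0" if "z \<in> Z" for z
            using Q(3)[OF that] s unfolding pairing_scale by (simp add: divide_le_0_iff)
        qed
        then show ?thesis
          using s unfolding pairing_scale Q(2) obj_def c_def s_def[symmetric]
          by (simp add: field_simps)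
      qed
    qed
  qed
  then obtain w where w: "\<And>d g. (d, g) \<in> S \<Longrightarrow> d + (\<Sum>z\<in>Z. w z * g z) \<ge> 0"
    by blast
  show ?thesis
  proof (rule that[OF P])
    have "w z \<ge> 0" if "z \<in> Z" for z
      using w[of 0 "indicator {z}"] that Z by (simp add: S_def indicator_def sum.delta)
    then show "\<forall>z\<in>Z. w z \<ge> 0" by blast
    show "\<forall>x\<in>N. pairing N P A \<le> row_gap N (\<lambda>x y. A x y + (\<Sum>z\<in>Z. w z * B z x y)) x"
    proof
      fix x assume x: "x \<in> N"
      define M where "M = (\<lambda>x y. A x y + (\<Sum>z\<in>Z. w z * B z x y))"
      define E where "E = {y \<in> N. M x y \<le> 0}"
      have "(obj (sign_row x E), \<lambda>z. pairing N (sign_row x E) (B z)) \<in> S"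
        using x by (auto simp: S_def E_def)
      from w[OF this] have "c \<le> pairing N (sign_row x E) A + (\<Sum>z\<in>Z. w z * pairing N (sign_row x E) (B z))"
        using N x by (simp add: obj_def trace_sign_row)
      also have "\<dots> = pairing N (sign_row x E) M"
        by (simp add: M_def pairing_plus_right pairing_sum_right)
      also have "\<dots> = row_gap N M x"
        unfolding E_def using N x by (rule pairing_sign_row)
      finally show "pairing N P A \<le> row_gap N M x" by (simp add: c_def M_def)
    qed
  qed
qed

subsection \<open>The matrix of the Hodge Laplacian\<close>

text \<open>Row \<open>x\<close>, column \<open>y\<close> of the matrix of
  \<open>\<delta>\<delta>\<^sup>*\<close>; in general it is symmetric only up to the
  weights.\<close>

definition down :: "'a complex_data \<Rightarrow> 'a \<Rightarrow> 'a \<Rightarrow> real" where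
  "down K x y = (\<Sum>v\<in>all_cells K.
     weight K y / weight K v * cobd K (indicator {v}) y * cobd K (indicator {v}) x)"

text \<open>The contribution of \<open>z\<close> to the matrix of
  \<open>\<delta>\<^sup>*\<delta>\<close>, with the weight of \<open>z\<close> taken out. What
  remains does not change under reweighting of the cofaces, and the matrix of \<open>H\<close> is
  affine in their weights.\<close>

definition coface_form :: "'a complex_data \<Rightarrow> 'a \<Rightarrow> 'a \<Rightarrow> 'a \<Rightarrow> real" where
  "coface_form K z x y = cobd K (indicator {x}) z * cobd K (indicator {y}) z / weight K x"

context cell_complex
begin

lemma cells_subset: "cells K i \<subseteq> all_cells K"
  by (auto simp: all_cells_def)

lemma cells_mem: "x \<in> cells K i \<Longrightarrow> x \<in> all_cells K"
  using cells_subset by blast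

lemma finite_cells_dim: "finite (cells K i)"
  using finite_cells cells_subset by (rule finite_subset[rotated])

lemma weight_pos_dim: "x \<in> cells K i \<Longrightarrow> weight K x > 0"
  using weight_pos cells_subset by blast

lemma cobd_dim:
  "\<lbrakk>v \<in> cells K i; z \<in> cells K j; cobd K (indicator {v}) z \<noteq> 0\<rbrakk> \<Longrightarrow> j = i + 1"
  using cobd_degree by blast

lemma all_cells_dim:
  assumes "x \<in> all_cells K" obtains i where "x \<in> cells K i"
  using assms by (auto simp: all_cells_def)

lemma fun_space_dim: "fun_space (cells K i) \<subseteq> fun_space (all_cells K)"
  using cells_subset by (auto simp: fun_space_def)

lemma cobd_expand:
  "f \<in> fun_space (all_cells K) \<Longrightarrow> cobd K f x = (\<Sum>v\<in>all_cells K. f v * cobd K (indicator {v}) x)"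
  using linear_operator_expand[OF linear_cobd finite_cells] .

lemma cobd_coadj:
  "cobd K (coadj K f) x = (\<Sum>y\<in>all_cells K. f y * down K x y)"
proof -
  have "coadj K f \<in> fun_space (all_cells K)"
    by (simp add: coadj_eq fun_space_def)
  then have "cobd K (coadj K f) x = (\<Sum>v\<in>all_cells K. \<Sum>y\<in>all_cells K.
      f y * (weight K y / weight K v * cobd K (indicator {v}) y * cobd K (indicator {v}) x))"
    by (simp add: cobd_expand coadj_eq sum_distrib_left sum_distrib_right mult_ac)
  also have "\<dots> = (\<Sum>y\<in>all_cells K. \<Sum>v\<in>all_cells K.
      f y * (weight K y / weight K v * cobd K (indicator {v}) y * cobd K (indicator {v}) x))"
    by (rule sum.swap)
  finally show ?thesis
    by (simp add: down_def sum_distrib_left)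
qed

lemma down_diff_dim:
  assumes "x \<in> cells K i" "y \<in> cells K j" "i \<noteq> j"
  shows "down K x y = 0"
  unfolding down_def
proof (intro sum.neutral ballI)
  fix v assume "v \<in> all_cells K"
  then obtain l where "v \<in> cells K l" by (rule all_cells_dim)
  then have "cobd K (indicator {v}) x = 0 \<or> cobd K (indicator {v}) y = 0"
    using assms cobd_dim by metis
  then show "weight K y / weight K v * cobd K (indicator {v}) y * cobd K (indicator {v}) x = 0"
    by auto
qed

text \<open>Cells of dimension above \<open>i\<close> are not faces of \<open>x\<close>, so the
  entry uses only cells that a subcomplex shares with \<open>K\<close>. The bound \<open>i\<close>
  in place of \<open>i - 1\<close> avoids a separate case for dimension zero.\<close>

lemma down_below:
  assumes "x \<in> cells K i"
  shows "down K x y = (\<Sum>v\<in>(\<Union>j\<le>i. cells K j).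
     weight K y / weight K v * cobd K (indicator {v}) y * cobd K (indicator {v}) x)"
  unfolding down_def
proof (rule sum.mono_neutral_right[OF finite_cells])
  show "\<forall>v\<in>all_cells K - (\<Union>j\<le>i. cells K j).
      weight K y / weight K v * cobd K (indicator {v}) y * cobd K (indicator {v}) x = 0"
  proof
    fix v assume v: "v \<in> all_cells K - (\<Union>j\<le>i. cells K j)"
    then obtain l where l: "v \<in> cells K l" by (auto simp: all_cells_def)
    with v have "\<not> l \<le> i" by auto
    with l have "cobd K (indicator {v}) x = 0"
      using cobd_degree[OF l assms] by simp
    then show "weight K y / weight K v * cobd K (indicator {v}) y * cobd K (indicator {v}) x = 0"
      by simp
  qed
qed (auto simp: all_cells_def)

text \<open>Self-adjointness of \<open>\<delta>\<delta>\<^sup>*\<close> for the weighted scalar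
  product, in terms of entries.\<close>

lemma down_weight_sym:
  assumes "x \<in> all_cells K" "y \<in> all_cells K"
  shows "down K x y * (weight K x / weight K y) = down K y x"
  using weight_pos[OF assms(2)]
  by (auto simp: down_def sum_distrib_left sum_distrib_right sum_divide_distrib mult_ac intro!: sum.cong)

lemma cobd_coadj_dim:
  assumes "f \<in> fun_space (cells K i)"
  shows "cobd K (coadj K f) x = (\<Sum>y\<in>cells K i. f y * down K x y)"
  unfolding cobd_coadj
  using assms cells_subset by (intro sum.mono_neutral_right[OF finite_cells]) (auto simp: fun_space_def)

lemma cobd_coadj_indicator:
  assumes "y \<in> all_cells K"
  shows "cobd K (coadj K (indicator {y})) x = down K x y"
proof -
  have "(\<Sum>u\<in>all_cells K. indicator {y} u * down K x u) = (\<Sum>u\<in>all_cells K. if u = y then down K x y else 0)"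
    by (intro sum.cong) (auto simp: indicator_def)
  then show ?thesis using assms finite_cells by (simp add: cobd_coadj)
qed

lemma coadj_cobd_indicator:
  assumes "x \<in> cells K i"
  shows "coadj K (cobd K (indicator {y})) x
    = (\<Sum>z\<in>cells K (i + 1). weight K z * coface_form K z x y)"
proof -
  have "coadj K (cobd K (indicator {y})) x
      = (\<Sum>z\<in>all_cells K. weight K z * coface_form K z x y)"
    using assms cells_subset[of i] by (auto simp: coadj_eq coface_form_def mult_ac intro!: sum.cong)
  also have "\<dots> = (\<Sum>z\<in>cells K (i + 1). weight K z * coface_form K z x y)"
    using assms cells_subset
    by (intro sum.mono_neutral_right[OF finite_cells])
      (auto simp: coface_form_def all_cells_def dest: cobd_dim)
  finally show ?thesis .
qed

lemma hodge_indicator: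
  assumes "x \<in> cells K i" "y \<in> all_cells K"
  shows "hodge K (indicator {y}) x
    = down K x y + (\<Sum>z\<in>cells K (i + 1). weight K z * coface_form K z x y)"
  by (simp add: hodge_def cobd_coadj_indicator[OF assms(2)] coadj_cobd_indicator[OF assms(1)])

lemma hodge_indicator_diff_dim:
  assumes "x \<in> cells K i" "y \<in> cells K j" "i \<noteq> j"
  shows "hodge K (indicator {y}) x = 0"
proof -
  have "coface_form K z x y = 0" if "z \<in> cells K (i + 1)" for z
    using that cobd_dim[OF assms(2) that] assms(3) by (auto simp: coface_form_def)
  then show ?thesis
    using hodge_indicator[OF assms(1) cells_mem[OF assms(2)]] down_diff_dim[OF assms] by simp
qed

text \<open>Both summands of \<open>H\<close> preserve dimension, so only cells of the dimension of
  \<open>x\<close> enter the off-diagonal sum.\<close>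

lemma forman_eq_row_gap:
  assumes x: "x \<in> cells K i"
  shows "forman K x = row_gap (cells K i)
    (\<lambda>x y. down K x y + (\<Sum>z\<in>cells K (i + 1). weight K z * coface_form K z x y)) x"
proof -
  have "(\<Sum>y\<in>all_cells K - {x}. \<bar>hodge K (indicator {y}) x\<bar>)
      = (\<Sum>y\<in>cells K i - {x}. \<bar>hodge K (indicator {y}) x\<bar>)"
    using finite_cells cells_subset hodge_indicator_diff_dim[OF x]
    by (intro sum.mono_neutral_right) (auto simp: all_cells_def)
  also have "\<dots> = (\<Sum>y\<in>cells K i - {x}.
      \<bar>down K x y + (\<Sum>z\<in>cells K (i + 1). weight K z * coface_form K z x y)\<bar>)"
    using hodge_indicator[OF x cells_mem] by (intro sum.cong) auto
  finally show ?thesis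
    using hodge_indicator[OF x cells_mem[OF x]]
    by (simp add: forman_def row_gap_def)
qed

text \<open>The sum runs over the cells of \<open>K\<close>, with weight zero for the removed ones.
  Every admissible \<open>K'\<close> thereby becomes a nonnegative weight vector on one fixed index
  set.\<close>

lemma forman_subcomplex_eq_row_gap:
  assumes sub: "cell_complex K'" "subcomplex_le k K' K" and x: "x \<in> cells K k"
  shows "forman K' x = row_gap (cells K k) (\<lambda>x y. down K x y + (\<Sum>z\<in>cells K (k + 1).
    (if z \<in> cells K' (k + 1) then weight K' z else 0) * coface_form K z x y)) x"
proof -
  interpret K': cell_complex K' by (rule sub(1))
  have same: "cells K' j = cells K j" if "j \<le> k" for j
    using sub(2) that by (simp add: subcomplex_le_def)
  have wt: "weight K' x = weight K x" if "x \<in> cells K j" "j \<le> k" for x j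
    using sub(2) that by (simp add: subcomplex_le_def)
  have inc: "cobd K' (indicator {v}) z = cobd K (indicator {v}) z"
    if "v \<in> all_cells K'" "z \<in> all_cells K'" for v z
    using sub(2) that by (simp add: subcomplex_le_def)
  have sub1: "cells K' (k + 1) \<subseteq> cells K (k + 1)"
    using sub(2) by (simp add: subcomplex_le_def)
  have memk: "u \<in> all_cells K'" if "u \<in> cells K j" "j \<le> k" for u j
    using K'.cells_subset same that by blast
  have eq: "down K' u y + (\<Sum>z\<in>cells K' (k + 1). weight K' z * coface_form K' z u y)
      = down K u y + (\<Sum>z\<in>cells K (k + 1).
          (if z \<in> cells K' (k + 1) then weight K' z else 0) * coface_form K z u y)"
    if u: "u \<in> cells K k" and y: "y \<in> cells K k" for u y
  proof -
    have "u \<in> cells K' k" using u same by simp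
    have "down K' u y = down K u y"
      unfolding down_below[OF u] K'.down_below[OF \<open>u \<in> cells K' k\<close>]
      using u y by (intro sum.cong) (auto simp: same wt inc memk)
    moreover have "(\<Sum>z\<in>cells K' (k + 1). weight K' z * coface_form K' z u y)
        = (\<Sum>z\<in>cells K (k + 1).
            (if z \<in> cells K' (k + 1) then weight K' z else 0) * coface_form K z u y)"
    proof (rule sum.mono_neutral_cong_left[OF finite_cells_dim sub1])
      show "weight K' z * coface_form K' z u y
          = (if z \<in> cells K' (k + 1) then weight K' z else 0) * coface_form K z u y"
        if "z \<in> cells K' (k + 1)" for z
        using that u y K'.cells_subset
        by (simp add: coface_form_def wt[of _ k] inc memk[of _ k] subset_iff)
    qed simp
    ultimately show ?thesis by simp
  qed
  have "x \<in> cells K' k" using x same by simp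
  then show ?thesis
    unfolding K'.forman_eq_row_gap[OF \<open>x \<in> cells K' k\<close>] same[OF order_refl]
    using x by (intro row_gap_cong eq)
qed

subsection \<open>Reweighted subcomplexes\<close>

text \<open>Cells of dimension \<open>k + 1\<close> where \<open>w\<close> is not positive are
  deleted, since a complex needs positive weights. The coboundary is cut off so that it maps into
  the functions on the remaining cells.\<close>

definition reweighted :: "nat \<Rightarrow> ('a \<Rightarrow> real) \<Rightarrow> 'a complex_data" where
  "reweighted k w = (let
     c = (\<lambda>j. if j \<le> k then cells K j else if j = k + 1 then {z \<in> cells K j. w z > 0} else {})
   in \<lparr> cells = c,
        cobd = (\<lambda>f x. if x \<in> (\<Union>j. c j) then cobd K f x else 0),
        weight = (\<lambda>x. if x \<in> cells K (k + 1) then w x else weight K x) \<rparr>)"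

lemma cells_reweighted:
  "cells (reweighted k w) j
    = (if j \<le> k then cells K j else if j = k + 1 then {z \<in> cells K j. w z > 0} else {})"
  by (simp add: reweighted_def Let_def)

lemma weight_reweighted:
  "weight (reweighted k w) x = (if x \<in> cells K (k + 1) then w x else weight K x)"
  by (simp add: reweighted_def Let_def)

lemma cobd_reweighted:
  "cobd (reweighted k w) f x = (if x \<in> all_cells (reweighted k w) then cobd K f x else 0)"
  by (simp only: reweighted_def Let_def all_cells_def complex_data.select_convs)

lemma cells_reweighted_subset: "cells (reweighted k w) j \<subseteq> cells K j"
  by (auto simp: cells_reweighted)

lemma all_cells_reweighted_subset: "all_cells (reweighted k w) \<subseteq> all_cells K"
  using cells_reweighted_subset by (fastforce simp: all_cells_def)

text \<open>A face of a remaining cell has dimension at most \<open>k\<close>, where nothing was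
  deleted. Hence the remaining cells are closed under passing to faces.\<close>

lemma covered_reweighted:
  assumes "z \<in> all_cells (reweighted k w)"
  shows "covered (reweighted k w) x z \<longleftrightarrow> covered K x z"
proof
  assume "covered (reweighted k w) x z"
  then show "covered K x z"
    using all_cells_reweighted_subset by (auto simp: covered_def cobd_reweighted split: if_splits)
next
  assume c: "covered K x z"
  obtain j where j: "z \<in> cells (reweighted k w) j"
    using assms by (auto simp: all_cells_def)
  then have "z \<in> cells K j" "j \<le> k + 1"
    using cells_reweighted_subset by (auto simp: cells_reweighted split: if_splits)
  moreover obtain i where i: "x \<in> cells K i"
    using c by (auto simp: covered_def all_cells_def)
  ultimately have "i \<le> k"
    using c cobd_dim[OF i, of z j] by (simp add: covered_def)
  with i have "x \<in> cells (reweighted k w) i"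
    by (simp add: cells_reweighted)
  then have "x \<in> all_cells (reweighted k w)"
    by (auto simp: all_cells_def)
  with c assms show "covered (reweighted k w) x z"
    by (simp add: covered_def cobd_reweighted)
qed

lemma covered_reweighted_mem:
  assumes "z \<in> all_cells (reweighted k w)" "covered K x z"
  shows "x \<in> all_cells (reweighted k w)"
  using covered_reweighted[OF assms(1)] assms(2) by (auto simp: covered_def)

text \<open>The axioms relate a cell only to its iterated faces, and those of a remaining cell are
  all kept.\<close>

lemma cell_complex_reweighted: "cell_complex (reweighted k w)"
proof -
  let ?R = "reweighted k w"
  note sub = all_cells_reweighted_subset[of k w] and csub = cells_reweighted_subset[of k w]
  have mem: "x \<in> all_cells ?R" if "x \<in> cells ?R j" for x j
    using that by (auto simp: all_cells_def)
  show ?thesis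
  proof
    show "finite (all_cells ?R)"
      using sub finite_cells by (rule finite_subset)
    show "cells ?R i \<inter> cells ?R j = {}" if "i \<noteq> j" for i j
      using disjoint_cells[OF that] csub by blast
    have fs: "f \<in> fun_space (all_cells K)" if "f \<in> fun_space (all_cells ?R)" for f
      using that sub by (auto simp: fun_space_def)
    show "linear_operator (all_cells ?R) (cobd ?R)"
      unfolding linear_operator_def
    proof (intro conjI ballI allI)
      show "cobd ?R f \<in> fun_space (all_cells ?R)" for f
        by (simp add: fun_space_def cobd_reweighted)
      show "cobd ?R (\<lambda>x. f x + g x) = (\<lambda>x. cobd ?R f x + cobd ?R g x)"
        if "f \<in> fun_space (all_cells ?R)" "g \<in> fun_space (all_cells ?R)" for f g
        using linear_operator_add[OF linear_cobd fs[OF that(1)] fs[OF that(2)]]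
        by (auto simp: cobd_reweighted)
      show "cobd ?R (\<lambda>x. c * f x) = (\<lambda>x. c * cobd ?R f x)"
        if "f \<in> fun_space (all_cells ?R)" for c f
        using linear_operator_scale[OF linear_cobd fs[OF that], of c]
        by (auto simp: cobd_reweighted)
    qed
    show "weight ?R x > 0" if x: "x \<in> all_cells ?R" for x
    proof (cases "x \<in> cells K (k + 1)")
      case True
      obtain j where j: "x \<in> cells ?R j" using x by (auto simp: all_cells_def)
      then have "j = k + 1"
        using True csub disjoint_cells[of j "k + 1"] by blast
      with j True show ?thesis
        by (simp add: cells_reweighted weight_reweighted)
    next
      case False
      then show ?thesis
        using x sub weight_pos by (auto simp: weight_reweighted)
    qed
    show "cobd ?R (indicator {v}) z \<in> {-1, 0, 1}" if "v \<in> all_cells ?R" "z \<in> all_cells ?R" for v z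
      using cobd_values[of v z] that sub by (auto simp: cobd_reweighted)
    show "cobd ?R (indicator {v}) z = 0" if "v \<in> cells ?R i" "z \<in> cells ?R j" "j \<noteq> i + 1" for v z i j
      using cobd_degree[of v i z j] that csub by (auto simp: cobd_reweighted)
    show "\<exists>x. covered ?R x z" if "z \<in> cells ?R j" "1 \<le> j" for z j
      using ex_face[of z j] that csub covered_reweighted[OF mem[OF that(1)]] by blast
    show "(\<exists>!w'. w' \<in> cells ?R 0 \<and> cobd ?R (indicator {w'}) x = 1) \<and>
        (\<exists>!w'. w' \<in> cells ?R 0 \<and> cobd ?R (indicator {w'}) x = -1)"
      if "x \<in> cells ?R 1" for x
    proof -
      have "x \<in> cells K 1" using that csub by blast
      from edge_endpoints[OF this] mem[OF that] show ?thesis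
        by (simp add: cobd_reweighted cells_reweighted[of _ _ 0])
    qed
    show "card {x. covered ?R v x \<and> covered ?R x z} = 2 \<and>
        {-1, 1} \<subseteq> {cobd ?R (indicator {v}) x * cobd ?R (indicator {x}) z | x. x \<in> all_cells ?R}"
      if v: "v \<in> cells ?R i" and z: "z \<in> cells ?R (i + 2)"
        and ne: "{x. covered ?R v x \<and> covered ?R x z} \<noteq> {}" for v i z
    proof -
      have eq: "{x. covered ?R v x \<and> covered ?R x z} = {x. covered K v x \<and> covered K x z}"
        using covered_reweighted[OF mem[OF z]] covered_reweighted covered_reweighted_mem[OF mem[OF z]]
        by blast
      have K: "v \<in> cells K i" "z \<in> cells K (i + 2)" using v z csub by auto
      note dia = diamond[OF K ne[unfolded eq]]
      have "r \<in> {cobd ?R (indicator {v}) x * cobd ?R (indicator {x}) z | x. x \<in> all_cells ?R}"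
        if r: "r \<in> {-1, 1}" for r
      proof -
        obtain x where x: "x \<in> all_cells K" "r = cobd K (indicator {v}) x * cobd K (indicator {x}) z"
          using dia r by blast
        \<comment> \<open>The product is nonzero, so the witness is a face of \<open>z\<close> and
          has not been deleted.\<close>
        with r have "covered K x z"
          using K cells_subset by (auto simp: covered_def)
        then have "x \<in> all_cells ?R"
          by (rule covered_reweighted_mem[OF mem[OF z]])
        with x show ?thesis using mem[OF z] by (auto simp: cobd_reweighted)
      qed
      with dia show ?thesis unfolding eq by blast
    qed
    show "\<exists>n p. p 0 = x \<and> p n = y \<and>
        (\<forall>i\<le>n. p i \<in> {u. covered ?R u z} \<union> {v. \<exists>u. covered ?R v u \<and> covered ?R u z}) \<and>
        (\<forall>i\<in>{1..n::nat}. cobd ?R (indicator {p i}) (p (i - 1)) + cobd ?R (indicator {p (i - 1)}) (p i) \<noteq> 0)"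
      if z: "z \<in> cells ?R j" and "2 \<le> j" and xy: "covered ?R x z" "covered ?R y z" for z j x y
    proof -
      have eq: "{u. covered ?R u z} \<union> {v. \<exists>u. covered ?R v u \<and> covered ?R u z}
          = {u. covered K u z} \<union> {v. \<exists>u. covered K v u \<and> covered K u z}"
        using covered_reweighted[OF mem[OF z]] covered_reweighted covered_reweighted_mem[OF mem[OF z]]
        by blast
      \<comment> \<open>The connecting path consists of faces of \<open>z\<close> and their faces,
        so it survives as a whole.\<close>
      have inR: "u \<in> all_cells ?R"
        if "u \<in> {u. covered K u z} \<union> {v. \<exists>u. covered K v u \<and> covered K u z}" for u
        using that covered_reweighted_mem covered_reweighted_mem[OF mem[OF z]] by blast
      have "z \<in> cells K j" "covered K x z" "covered K y z"
        using z xy csub covered_reweighted[OF mem[OF z]] by auto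
      from boundary_connected[OF this(1) \<open>2 \<le> j\<close> this(2,3)] obtain n p where p: "p 0 = x" "p n = y"
        "\<forall>i\<le>n. p i \<in> {u. covered K u z} \<union> {v. \<exists>u. covered K v u \<and> covered K u z}"
        "\<forall>i\<in>{1..n::nat}. cobd K (indicator {p i}) (p (i - 1)) + cobd K (indicator {p (i - 1)}) (p i) \<noteq> 0"
        by blast
      have pR: "p i \<in> all_cells ?R" if "i \<le> n" for i
        using p(3) that inR by blast
      have "cobd ?R (indicator {p i}) (p (i - 1)) + cobd ?R (indicator {p (i - 1)}) (p i) \<noteq> 0"
        if "i \<in> {1..n}" for i
      proof -
        have "i \<le> n" "i - 1 \<le> n" using that by auto
        with p(4)[rule_format, OF that] show ?thesis
          by (simp only: cobd_reweighted pR simp_thms if_True)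
      qed
      with p show ?thesis unfolding eq by blast
    qed
    show "z = z'" if z: "z \<in> cells ?R j" and "1 \<le> j" and z': "z' \<in> all_cells ?R"
      and faces: "{x. covered ?R x z} = {x. covered ?R x z'}" for z j z'
      using faces_determine[of z j z'] z csub z' sub \<open>1 \<le> j\<close> faces
        covered_reweighted[OF mem[OF z]] covered_reweighted[OF z'] by auto
  qed
qed

lemma subcomplex_reweighted: "subcomplex_le k (reweighted k w) K"
proof -
  have "x \<notin> cells K (k + 1)" if "x \<in> cells K j" "j \<le> k" for x j
    using that disjoint_cells[of j "k + 1"] by auto
  then show ?thesis
    by (auto simp: subcomplex_le_def cells_reweighted weight_reweighted cobd_reweighted)
qed

lemma forman_reweighted:
  assumes "x \<in> cells K k" "\<And>z. z \<in> cells K (k + 1) \<Longrightarrow> w z \<ge> 0"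
  shows "forman (reweighted k w) x = row_gap (cells K k)
    (\<lambda>x y. down K x y + (\<Sum>z\<in>cells K (k + 1). w z * coface_form K z x y)) x"
proof -
  have "(\<Sum>z\<in>cells K (k + 1). (if z \<in> cells (reweighted k w) (k + 1)
          then weight (reweighted k w) z else 0) * coface_form K z x y)
      = (\<Sum>z\<in>cells K (k + 1). w z * coface_form K z x y)" for x y
  proof (rule sum.cong[OF refl])
    fix z assume z: "z \<in> cells K (k + 1)"
    from assms(2)[OF this] consider "w z > 0" | "w z = 0" by linarith
    then show "(if z \<in> cells (reweighted k w) (k + 1) then weight (reweighted k w) z else 0) *
        coface_form K z x y = w z * coface_form K z x y"
      by cases (use z in \<open>simp_all add: cells_reweighted weight_reweighted\<close>)
  qed
  then show ?thesis
    using forman_subcomplex_eq_row_gap[OF cell_complex_reweighted subcomplex_reweighted assms(1), of w]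
    by simp
qed

subsection \<open>Feasibility of the dual problem\<close>

text \<open>No cell other than \<open>x\<close> and \<open>y\<close> lies between \<open>c\<close>
  and \<open>z\<close>, so the values 1 and -1, which both occur, belong to \<open>x\<close> and
  \<open>y\<close> in some order.\<close>

lemma diamond_sign:
  assumes c: "c \<in> cells K i" and z: "z \<in> cells K (i + 2)" and "x \<noteq> y"
    and x: "covered K c x" "covered K x z" and y: "covered K c y" "covered K y z"
  shows "(cobd K (indicator {c}) x * cobd K (indicator {x}) z) *
    (cobd K (indicator {c}) y * cobd K (indicator {y}) z) = - 1"
proof -
  let ?U = "{u. covered K c u \<and> covered K u z}"
  let ?p = "\<lambda>u. cobd K (indicator {c}) u * cobd K (indicator {u}) z"
  have "?U \<noteq> {}" using x by blast
  note dia = diamond[OF c z this]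
  have "{x, y} = ?U"
    using dia x y \<open>x \<noteq> y\<close> by (intro card_subset_eq) (auto intro: card_ge_0_finite)
  then have U: "u = x \<or> u = y" if "u \<in> all_cells K" "?p u \<noteq> 0" for u
    using that cells_mem[OF c] cells_mem[OF z] by (auto simp: covered_def)
  obtain u where u: "u \<in> all_cells K" "?p u = 1" using dia by force
  obtain v where v: "v \<in> all_cells K" "?p v = -1" using dia by force
  show ?thesis
    using U[of u] U[of v] u v by auto
qed

text \<open>Vertices have no faces to share; all of them count as linked, as if they had a common
  empty face of dimension -1.\<close>

definition linked :: "nat \<Rightarrow> 'a \<Rightarrow> 'a \<Rightarrow> bool" where
  "linked k x y \<longleftrightarrow> k = 0 \<or> (\<exists>c. covered K c x \<and> covered K c y)"

text \<open>By the diamond property, linked faces of a cell carry a relative orientation that does not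
  depend on the cell.\<close>

lemma relative_orientation:
  assumes x: "x \<in> cells K k" and y: "y \<in> cells K k" and "x \<noteq> y"
  shows "\<exists>e. \<bar>e\<bar> \<le> 1 \<and> (linked k x y \<or> e = 0) \<and> (\<forall>z\<in>cells K (k + 1).
    linked k x y \<and> covered K x z \<and> covered K y z \<longrightarrow>
      e * (cobd K (indicator {x}) z * cobd K (indicator {y}) z) = - 1)"
proof (cases "linked k x y")
  case False
  then show ?thesis by (intro exI[of _ 0]) auto
next
  case True
  show ?thesis
  proof (cases "k = 0")
    case True
    \<comment> \<open>The two ends of an edge carry opposite signs, so \<open>e = 1\<close> works
      for vertices.\<close>
    have "cobd K (indicator {x}) z * cobd K (indicator {y}) z = - 1"
      if z: "z \<in> cells K 1" "covered K x z" "covered K y z" for z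
    proof -
      have "cobd K (indicator {x}) z \<in> {- 1, 1}" "cobd K (indicator {y}) z \<in> {- 1, 1}"
        using z(2,3) cobd_values by (force simp: covered_def)+
      moreover have "cobd K (indicator {x}) z \<noteq> cobd K (indicator {y}) z"
        using calculation edge_endpoints[OF z(1)] x y \<open>x \<noteq> y\<close> True by auto
      ultimately show ?thesis by auto
    qed
    with True show ?thesis by (intro exI[of _ 1]) (simp add: linked_def)
  next
    case False
    with True obtain c where c: "covered K c x" "covered K c y"
      by (auto simp: linked_def)
    obtain i where i: "c \<in> cells K i"
      using c by (auto simp: covered_def all_cells_def)
    have k: "k = i + 1"
      using c cobd_dim[OF i x] by (simp add: covered_def)
    \<comment> \<open>Any common face \<open>c\<close> will do: \<open>diamond_sign\<close> gives
      the relation for every common coface \<open>z\<close> of \<open>x\<close> and \<open>y\<close>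
      at once.\<close>
    let ?e = "cobd K (indicator {c}) x * cobd K (indicator {c}) y"
    have "\<bar>?e\<bar> \<le> 1"
      using c cobd_values[of c x] cobd_values[of c y] by (auto simp: covered_def)
    moreover have "?e * (cobd K (indicator {x}) z * cobd K (indicator {y}) z) = - 1"
      if "z \<in> cells K (k + 1)" "covered K x z" "covered K y z" for z
      using diamond_sign[OF i _ \<open>x \<noteq> y\<close> c(1) that(2) c(2) that(3)] that(1) k
      by (simp add: mult_ac)
    ultimately show ?thesis using True by blast
  qed
qed

text \<open>The diamond between a face of \<open>x\<close> and \<open>z\<close> has a second middle
  cell; for a vertex \<open>x\<close> it is the other end of the edge \<open>z\<close>.\<close>

lemma ex_linked_face:
  assumes x: "x \<in> cells K k" and z: "z \<in> cells K (k + 1)" and xz: "covered K x z"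
  obtains y where "y \<in> cells K k" "y \<noteq> x" "linked k x y" "covered K y z"
proof (cases "k = 0")
  case True
  then have "z \<in> cells K 1" using z by simp
  from edge_endpoints[OF this] obtain u v where uv: "u \<in> cells K 0" "cobd K (indicator {u}) z = 1"
    "v \<in> cells K 0" "cobd K (indicator {v}) z = - 1" by blast
  then have "u \<noteq> v" by auto
  with uv that show ?thesis
    using True cells_mem[OF z] cells_mem[OF uv(1)] cells_mem[OF uv(3)]
    by (cases "x = u") (auto simp: covered_def linked_def)
next
  case False
  then obtain c where c: "covered K c x" using ex_face[OF x] by auto
  obtain i where i: "c \<in> cells K i"
    using c by (auto simp: covered_def all_cells_def)
  have k: "k = i + 1"
    using c cobd_dim[OF i x] by (simp add: covered_def)
  let ?U = "{u. covered K c u \<and> covered K u z}"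
  have "x \<in> ?U" using c xz by simp
  then have "card ?U = 2" using diamond[OF i, of z] z k by auto
  then obtain y where y: "y \<in> ?U" "y \<noteq> x"
    by (metis \<open>x \<in> ?U\<close> card_2_iff insertCI)
  obtain j where j: "y \<in> cells K j"
    using y by (auto simp: covered_def all_cells_def)
  have "j = k"
    using y cobd_dim[OF j z] by (simp add: covered_def)
  with j y c show ?thesis by (intro that[of y]) (auto simp: linked_def)
qed

text \<open>The matrix lives in row \<open>x\<close> and has the relative orientations as entries.
  Up to the factor \<open>1 / weight K x\<close>, a coface \<open>z\<close> of \<open>x\<close>
  contributes 1 on the diagonal, -1 from a linked second face, and nothing positive
  elsewhere.\<close>

lemma ex_feasible:
  assumes x: "x \<in> cells K k"
  obtains P where "dominated (cells K k) P" "(\<Sum>u\<in>cells K k. P u u) = 1"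
    "\<And>z. z \<in> cells K (k + 1) \<Longrightarrow> pairing (cells K k) P (coface_form K z) \<le> 0"
proof -
  let ?N = "cells K k"
  have "\<forall>y\<in>?N - {x}. \<exists>e. \<bar>e\<bar> \<le> 1 \<and> (linked k x y \<or> e = 0) \<and> (\<forall>z\<in>cells K (k + 1).
    linked k x y \<and> covered K x z \<and> covered K y z \<longrightarrow>
      e * (cobd K (indicator {x}) z * cobd K (indicator {y}) z) = - 1)"
    using relative_orientation[OF x] by blast
  from bchoice[OF this] obtain e where e: "\<And>y. y \<in> ?N - {x} \<Longrightarrow> \<bar>e y\<bar> \<le> 1"
    "\<And>y. y \<in> ?N - {x} \<Longrightarrow> linked k x y \<or> e y = 0"
    "\<And>y z. y \<in> ?N - {x} \<Longrightarrow> z \<in> cells K (k + 1) \<Longrightarrow> linked k x y \<Longrightarrow> covered K x z \<Longrightarrow> covered K y z \<Longrightarrow>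
      e y * (cobd K (indicator {x}) z * cobd K (indicator {y}) z) = - 1" by blast
  define P where "P = (\<lambda>u v. if u = x then if v = x then 1 else e v else 0)"
  show ?thesis
  proof (rule that[of P])
    show "dominated ?N P" using e(1) by (auto simp: dominated_def P_def)
    show "(\<Sum>u\<in>?N. P u u) = 1"
      using x finite_cells_dim by (simp add: P_def)
    fix z assume z: "z \<in> cells K (k + 1)"
    define t where "t = (\<lambda>y. cobd K (indicator {x}) z * cobd K (indicator {y}) z)"
    have "pairing ?N P (coface_form K z) = (\<Sum>u\<in>?N. if u = x then \<Sum>y\<in>?N. P x y * t y / weight K x else 0)"
      unfolding pairing_def by (intro sum.cong) (auto simp: P_def t_def coface_form_def)
    also have "\<dots> = (\<Sum>y\<in>?N. P x y * t y) / weight K x"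
      using x finite_cells_dim by (simp add: sum_divide_distrib)
    also have "(\<Sum>y\<in>?N. P x y * t y) = t x + (\<Sum>y\<in>?N - {x}. e y * t y)"
      using x finite_cells_dim by (simp add: sum.remove[of ?N x] P_def)
    finally have eq: "pairing ?N P (coface_form K z) = (t x + (\<Sum>y\<in>?N - {x}. e y * t y)) / weight K x" .
    have "t x + (\<Sum>y\<in>?N - {x}. e y * t y) \<le> 0"
    proof (cases "covered K x z")
      case False
      then have "t y = 0" for y
        using cells_mem[OF x] cells_mem[OF z] by (simp add: t_def covered_def)
      then show ?thesis by simp
    next
      case True
      obtain y where y: "y \<in> ?N" "y \<noteq> x" "linked k x y" "covered K y z"
        by (rule ex_linked_face[OF x z True])
      have nonpos: "e u * t u \<le> 0" if "u \<in> ?N - {x}" for u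
      proof (cases "linked k x u \<and> covered K u z")
        case True
        then show ?thesis using e(3)[OF that z _ \<open>covered K x z\<close>] by (simp add: t_def)
      next
        case False
        then have "e u = 0 \<or> t u = 0"
          using e(2)[OF that] that cells_mem cells_mem[OF z] by (auto simp: t_def covered_def)
        then show ?thesis by auto
      qed
      have "(\<Sum>u\<in>?N - {x}. e u * t u) = e y * t y + (\<Sum>u\<in>?N - {x} - {y}. e u * t u)"
        using y finite_cells_dim by (intro sum.remove) auto
      also have "\<dots> \<le> e y * t y"
        using sum_nonpos[of "?N - {x} - {y}" "\<lambda>u. e u * t u"] nonpos by simp
      also have "\<dots> = - 1"
        using e(3)[of y z] y z True by (simp add: t_def)
      \<comment> \<open>\<open>t x\<close> is the square of an incidence number, hence at most
        one.\<close>
      finally show ?thesis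
        using cobd_values[OF cells_mem[OF x] cells_mem[OF z]] by (auto simp: t_def)
    qed
    then show "pairing ?N P (coface_form K z) \<le> 0"
      unfolding eq using weight_pos_dim[OF x] by (simp add: divide_le_0_iff)
  qed
qed

subsection \<open>Operators and matrices\<close>

text \<open>The matrix of \<open>J\<close> conjugated by the diagonal matrix of weights. This keeps
  the diagonal, hence the trace, and turns (a) into domination.\<close>

definition op_matrix :: "(('a \<Rightarrow> real) \<Rightarrow> 'a \<Rightarrow> real) \<Rightarrow> 'a \<Rightarrow> 'a \<Rightarrow> real" where
  "op_matrix J x y = J (indicator {y}) x * (weight K x / weight K y)"

lemma dominated_op_matrix:
  "dominated (cells K k) (op_matrix J) \<longleftrightarrow> (\<forall>x\<in>cells K k. \<forall>y\<in>cells K k.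
     J (indicator {x}) x / weight K x \<ge> \<bar>J (indicator {y}) x\<bar> / weight K y)"
proof -
  have "\<bar>op_matrix J x y\<bar> \<le> op_matrix J x x \<longleftrightarrow>
      J (indicator {x}) x / weight K x \<ge> \<bar>J (indicator {y}) x\<bar> / weight K y"
    if "x \<in> cells K k" "y \<in> cells K k" for x y
    using weight_pos_dim[OF that(1)] weight_pos_dim[OF that(2)]
    by (simp add: op_matrix_def abs_mult field_simps)
  then show ?thesis by (simp add: dominated_def)
qed

lemma trace_op_matrix: "(\<Sum>x\<in>cells K k. op_matrix J x x) = trace_on (cells K k) J"
  unfolding trace_on_def
  by (intro sum.cong) (auto simp: op_matrix_def dest: weight_pos_dim)

text \<open>The trace of a composition pairs \<open>J\<close> with the transpose of
  \<open>down\<close>; by \<open>down_weight_sym\<close> the weights in \<open>op_matrix\<close>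
  undo the transposition.\<close>

lemma trace_cobd_coadj:
  assumes J: "linear_operator (cells K k) J"
  shows "trace_on (cells K k) (\<lambda>f. cobd K (coadj K (J f))) = pairing (cells K k) (op_matrix J) (down K)"
proof -
  have "J (indicator {x}) \<in> fun_space (cells K k)" if "x \<in> cells K k" for x
    using J indicator_in_fun_space[OF that] by (auto simp: linear_operator_def)
  then have "trace_on (cells K k) (\<lambda>f. cobd K (coadj K (J f)))
      = (\<Sum>x\<in>cells K k. \<Sum>y\<in>cells K k. J (indicator {x}) y * down K x y)"
    unfolding trace_on_def by (intro sum.cong refl cobd_coadj_dim)
  also have "\<dots> = (\<Sum>x\<in>cells K k. \<Sum>y\<in>cells K k. op_matrix J y x * down K y x)"
  proof (intro sum.cong refl)
    fix x y assume "x \<in> cells K k" "y \<in> cells K k"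
    then have "down K x y = down K y x * (weight K y / weight K x)"
      by (simp only: down_weight_sym cells_mem)
    then show "J (indicator {x}) y * down K x y = op_matrix J y x * down K y x"
      by (simp add: op_matrix_def)
  qed
  also have "\<dots> = pairing (cells K k) (op_matrix J) (down K)"
    unfolding pairing_def by (rule sum.swap)
  finally show ?thesis .
qed

text \<open>As \<open>weight K z\<close> is positive, this makes (b) a sign condition on the
  pairing.\<close>

lemma cobd_op_coadj:
  assumes J: "linear_operator (cells K k) J" and z: "z \<in> cells K (k + 1)"
  shows "cobd K (J (coadj K (indicator {z}))) z
    = weight K z * pairing (cells K k) (op_matrix J) (coface_form K z)"
proof -
  let ?g = "coadj K (indicator {z})"
  have g: "?g v = weight K z / weight K v * cobd K (indicator {v}) z" if "v \<in> all_cells K" for v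
  proof -
    have "?g v = (\<Sum>x\<in>all_cells K. if x = z then weight K z / weight K v * cobd K (indicator {v}) z else 0)"
      using that unfolding coadj_eq by (auto intro!: sum.cong simp: indicator_def)
    then show ?thesis using finite_cells cells_mem[OF z] by simp
  qed
  \<comment> \<open>\<open>J\<close> is controlled only on functions supported in dimension
    \<open>k\<close>; the adjoint lowers the dimension of \<open>z\<close> by one, so its value is
    such a function.\<close>
  have gk: "?g \<in> fun_space (cells K k)"
    unfolding fun_space_def
  proof (intro CollectI allI impI)
    fix v assume v: "v \<notin> cells K k"
    show "?g v = 0"
    proof (cases "v \<in> all_cells K")
      case True
      then obtain i where "v \<in> cells K i" by (rule all_cells_dim)
      then have "cobd K (indicator {v}) z = 0"
        using cobd_dim[OF _ z] v by auto
      with g[OF True] show ?thesis by simp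
    qed (simp add: coadj_eq)
  qed
  then have "J ?g \<in> fun_space (cells K k)"
    using J by (auto simp: linear_operator_def)
  then have "cobd K (J ?g) z = (\<Sum>x\<in>cells K k. J ?g x * cobd K (indicator {x}) z)"
    using fun_space_dim finite_cells cells_subset
    by (subst cobd_expand) (auto intro!: sum.mono_neutral_right simp: fun_space_def dest: cells_mem)
  also have "\<dots> = (\<Sum>x\<in>cells K k. \<Sum>y\<in>cells K k. weight K z * (op_matrix J x y * coface_form K z x y))"
  proof (rule sum.cong[OF refl])
    fix x assume x: "x \<in> cells K k"
    show "J ?g x * cobd K (indicator {x}) z
        = (\<Sum>y\<in>cells K k. weight K z * (op_matrix J x y * coface_form K z x y))"
      unfolding linear_operator_expand[OF J finite_cells_dim gk] sum_distrib_right
      using weight_pos_dim[OF x]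
      by (intro sum.cong refl) (simp add: g cells_mem op_matrix_def coface_form_def mult_ac)
  qed
  finally show ?thesis by (simp add: pairing_def sum_distrib_left)
qed

lemma ex_operator_of_matrix:
  obtains J where "linear_operator (cells K k) J"
    "\<And>x y. x \<in> cells K k \<Longrightarrow> y \<in> cells K k \<Longrightarrow> op_matrix J x y = P x y"
proof -
  define J where "J = (\<lambda>f x. if x \<in> cells K k then \<Sum>y\<in>cells K k. f y * (P x y * (weight K y / weight K x)) else 0)"
  have "linear_operator (cells K k) J"
    by (auto simp: linear_operator_def J_def fun_space_def sum.distrib sum_distrib_left distrib_left add_divide_distrib mult_ac fun_eq_iff)
  moreover have "op_matrix J x y = P x y" if "x \<in> cells K k" "y \<in> cells K k" for x y
  proof -
    have "(\<Sum>u\<in>cells K k. indicator {y} u * (P x u * (weight K u / weight K x)))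
        = (\<Sum>u\<in>cells K k. if u = y then P x y * (weight K y / weight K x) else 0)"
      by (intro sum.cong) (auto simp: indicator_def)
    then show ?thesis
      using that weight_pos_dim[OF that(1)] weight_pos_dim[OF that(2)] finite_cells_dim
      by (simp add: op_matrix_def J_def)
  qed
  ultimately show ?thesis by (rule that)
qed

section \<open>Equivalence of (a) and (a')\<close>

lemma scalar_prod_indicator:
  assumes "x \<in> all_cells K"
  shows "scalar_prod K (indicator {x}) f = f x * weight K x"
proof -
  have "scalar_prod K (indicator {x}) f = (\<Sum>u\<in>all_cells K. if u = x then f x * weight K x else 0)"
    unfolding scalar_prod_def by (intro sum.cong) (auto simp: indicator_def)
  then show ?thesis using assms finite_cells by simp
qed

lemma norm1_dim:
  assumes "f \<in> fun_space (cells K k)"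
  shows "norm1 K f = (\<Sum>x\<in>cells K k. weight K x * \<bar>f x\<bar>)"
  unfolding norm1_def
  using assms cells_subset finite_cells
  by (intro sum.mono_neutral_right) (auto simp: fun_space_def)

text \<open>The premise of (a') says that \<open>f x * weight K x\<close> is at least the sum of
  \<open>weight K y * |f y|\<close> over the other cells, and (a) bounds the off-diagonal part of
  \<open>J f x\<close> by a multiple of that sum. Conversely, (a) follows from suitable test
  functions.\<close>

lemma dominated_iff_nonneg:
  assumes J: "linear_operator (cells K k) J"
  shows "(\<forall>x\<in>cells K k. \<forall>y\<in>cells K k.
      J (indicator {x}) x / weight K x \<ge> \<bar>J (indicator {y}) x\<bar> / weight K y) \<longleftrightarrow>
    (\<forall>x\<in>cells K k. \<forall>f\<in>fun_space (cells K k).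
      2 * scalar_prod K (indicator {x}) f \<ge> norm1 K f \<longrightarrow> J f x \<ge> 0)"
    (is "?dom \<longleftrightarrow> ?nonneg")
proof
  let ?N = "cells K k"
  assume dom: ?dom
  show ?nonneg
  proof (intro ballI impI)
    fix x f assume x: "x \<in> ?N" and f: "f \<in> fun_space ?N"
      and le: "norm1 K f \<le> 2 * scalar_prod K (indicator {x}) f"
    define r where "r = J (indicator {x}) x / weight K x"
    define s where "s = (\<Sum>y\<in>?N - {x}. weight K y * \<bar>f y\<bar>)"
    have mx: "weight K x > 0" by (rule weight_pos_dim[OF x])
    have r: "r \<ge> \<bar>J (indicator {y}) x\<bar> / weight K y" if "y \<in> ?N" for y
      using dom x that by (simp add: r_def)
    have "r \<ge> 0"
      by (rule order_trans[OF _ r[OF x]]) (use mx in simp)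
    have "s \<ge> 0"
      unfolding s_def by (intro sum_nonneg) (auto dest!: weight_pos_dim)
    have "norm1 K f = weight K x * \<bar>f x\<bar> + s"
      using x finite_cells_dim by (simp add: norm1_dim[OF f] sum.remove[of ?N x] s_def)
    then have le': "weight K x * \<bar>f x\<bar> + s \<le> 2 * (f x * weight K x)"
      using le by (simp add: scalar_prod_indicator cells_mem[OF x])
    have "f x * weight K x \<le> weight K x * \<bar>f x\<bar>"
      using mx by (simp add: mult.commute)
    with le' have "s \<le> f x * weight K x" by linarith
    have "- (r * s) = (\<Sum>y\<in>?N - {x}. - (r * (weight K y * \<bar>f y\<bar>)))"
      by (simp add: s_def sum_distrib_left sum_negf)
    also have "\<dots> \<le> (\<Sum>y\<in>?N - {x}. f y * J (indicator {y}) x)"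
    proof (rule sum_mono)
      fix y assume y: "y \<in> ?N - {x}"
      then have "\<bar>J (indicator {y}) x\<bar> \<le> r * weight K y"
        using r[of y] weight_pos_dim[of y k] by (simp add: pos_divide_le_eq)
      then have "\<bar>f y\<bar> * \<bar>J (indicator {y}) x\<bar> \<le> \<bar>f y\<bar> * (r * weight K y)"
        by (intro mult_left_mono) auto
      then have "\<bar>f y * J (indicator {y}) x\<bar> \<le> r * (weight K y * \<bar>f y\<bar>)"
        by (simp add: abs_mult mult_ac)
      then show "- (r * (weight K y * \<bar>f y\<bar>)) \<le> f y * J (indicator {y}) x" by linarith
    qed
    finally have "f x * J (indicator {x}) x - r * s \<le> J f x"
      using x finite_cells_dim
      by (simp add: linear_operator_expand[OF J finite_cells_dim f] sum.remove[of ?N x])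
    moreover have "f x * J (indicator {x}) x = r * (f x * weight K x)"
      using mx by (simp add: r_def)
    moreover have "r * s \<le> r * (f x * weight K x)"
      using \<open>s \<le> _\<close> \<open>r \<ge> 0\<close> by (rule mult_left_mono)
    ultimately show "J f x \<ge> 0" by linarith
  qed
next
  let ?N = "cells K k"
  assume nonneg: ?nonneg
  show ?dom
  proof (intro ballI)
    fix x y assume x: "x \<in> ?N" and y: "y \<in> ?N"
    note mx = weight_pos_dim[OF x] and my = weight_pos_dim[OF y]
    show "\<bar>J (indicator {y}) x\<bar> / weight K y \<le> J (indicator {x}) x / weight K x"
    proof (cases "y = x")
      case True
      have "norm1 K (indicator {x}) = weight K x"
        using x finite_cells_dim unfolding norm1_dim[OF indicator_in_fun_space[OF x]]
        by (simp add: sum.remove[of ?N x] indicator_def)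
      then have "J (indicator {x}) x \<ge> 0"
        using nonneg x indicator_in_fun_space[OF x] mx
        by (simp add: scalar_prod_indicator cells_mem[OF x])
      with True show ?thesis by simp
    next
      case False
      have "J (indicator {x}) x / weight K x + e * (J (indicator {y}) x / weight K y) \<ge> 0"
        if e: "\<bar>e\<bar> = 1" for e
      proof -
        \<comment> \<open>This function has norm 2 and scalar product 1 with \<open>x\<close>, so
          the premise of (a') holds with equality. The two signs of \<open>e\<close> yield the two
          halves of the absolute value bound.\<close>
        define f where "f = (\<lambda>u. indicator {x} u / weight K x + e * (indicator {y} u / weight K y))"
        have f: "f \<in> fun_space ?N"
          using x y by (auto simp: f_def fun_space_def indicator_def)
        have split: "sum h ?N = h x + (h y + sum h (?N - {x} - {y}))" for h :: "'a \<Rightarrow> real"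
          using x y False finite_cells_dim[of k] by (simp add: sum.remove[of ?N x] sum.remove[of "?N - {x}" y])
        have "norm1 K f = 2"
          unfolding norm1_dim[OF f] split using mx my False e by (simp add: f_def abs_mult)
        moreover have "scalar_prod K (indicator {x}) f = 1"
          using mx False by (simp add: scalar_prod_indicator cells_mem[OF x] f_def)
        ultimately have "J f x \<ge> 0" using nonneg x f by simp
        moreover have "J f x = J (indicator {x}) x / weight K x + e * (J (indicator {y}) x / weight K y)"
          unfolding linear_operator_expand[OF J finite_cells_dim f] split
          using False by (simp add: f_def)
        ultimately show ?thesis by simp
      qed
      from this[of 1] this[of "- 1"] show ?thesis
        using my by (simp add: abs_if)
    qed
  qed
qed

section \<open>Equality of the two optima\<close>

lemma forman_duality:
  assumes ne: "cells K k \<noteq> {}"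
  shows "\<exists>c.
    is_maximum {Min (forman K' ` cells K k) | K'. cell_complex K' \<and> subcomplex_le k K' K} c \<and>
    is_minimum {trace_on (cells K k) (\<lambda>f. cobd K (coadj K (J f))) | J.
        linear_operator (cells K k) J \<and>
        (\<forall>x\<in>cells K k. \<forall>y\<in>cells K k.
           J (indicator {x}) x / weight K x \<ge> \<bar>J (indicator {y}) x\<bar> / weight K y) \<and>
        (\<forall>z\<in>cells K (k + 1). cobd K (J (coadj K (indicator {z}))) z \<le> 0) \<and>
        trace_on (cells K k) J = 1} c"
    (is "\<exists>c. is_maximum ?curvatures c \<and> is_minimum ?traces c")
proof -
  let ?N = "cells K k" and ?Z = "cells K (k + 1)"
  let ?M = "\<lambda>w x y. down K x y + (\<Sum>z\<in>?Z. w z * coface_form K z x y)"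
  have fin: "finite ?N" "finite ?Z" by (rule finite_cells_dim)+
  have boundary: "cobd K (J (coadj K (indicator {z}))) z \<le> 0
      \<longleftrightarrow> pairing ?N (op_matrix J) (coface_form K z) \<le> 0"
    if "linear_operator ?N J" "z \<in> ?Z" for J z
    using weight_pos_dim[OF that(2)] by (simp add: cobd_op_coadj[OF that] mult_le_0_iff)
  have traces: "?traces = {pairing ?N (op_matrix J) (down K) | J. linear_operator ?N J \<and>
      dominated ?N (op_matrix J) \<and> (\<forall>z\<in>?Z. pairing ?N (op_matrix J) (coface_form K z) \<le> 0) \<and>
      (\<Sum>x\<in>?N. op_matrix J x x) = 1}"
    unfolding dominated_op_matrix trace_op_matrix
    by (intro Collect_cong ex_cong1) (auto simp: boundary trace_cobd_coadj)
  \<comment> \<open>Weak duality: by (b) the nonnegative weights of the cofaces can only lower the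
    pairing.\<close>
  have weak: "Min (forman K' ` ?N) \<le> pairing ?N P (down K)"
    if K': "cell_complex K'" "subcomplex_le k K' K"
      and P: "dominated ?N P" "(\<Sum>x\<in>?N. P x x) = 1" "\<forall>z\<in>?Z. pairing ?N P (coface_form K z) \<le> 0"
    for K' P
  proof -
    interpret K': cell_complex K' by (rule K'(1))
    define w where "w = (\<lambda>z. if z \<in> cells K' (k + 1) then weight K' z else 0)"
    have "w z \<ge> 0" for z
      using K'.weight_pos_dim[of z "k + 1"] by (auto simp: w_def)
    have "Min (forman K' ` ?N) \<le> pairing ?N P (?M w)"
    proof (rule row_gap_bound_le_pairing[OF fin(1) P(1,2)])
      fix x assume x: "x \<in> ?N"
      then have "Min (forman K' ` ?N) \<le> forman K' x"
        using fin by simp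
      also have "\<dots> = row_gap ?N (?M w) x"
        unfolding w_def by (rule forman_subcomplex_eq_row_gap[OF K' x])
      finally show "Min (forman K' ` ?N) \<le> row_gap ?N (?M w) x" .
    qed
    also have "\<dots> = pairing ?N P (down K) + (\<Sum>z\<in>?Z. w z * pairing ?N P (coface_form K z))"
      by (simp add: pairing_plus_right pairing_sum_right)
    also have "\<dots> \<le> pairing ?N P (down K)"
      using P(3) \<open>\<And>z. w z \<ge> 0\<close> by (simp add: sum_nonpos mult_nonneg_nonpos)
    finally show ?thesis .
  qed
  obtain x where "x \<in> ?N" using ne by blast
  then obtain P0 where P0: "dominated ?N P0" "(\<Sum>u\<in>?N. P0 u u) = 1"
    "\<And>z. z \<in> ?Z \<Longrightarrow> pairing ?N P0 (coface_form K z) \<le> 0" by (rule ex_feasible) blast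
  obtain P w where P: "dominated ?N P" "(\<Sum>x\<in>?N. P x x) = 1"
      "\<forall>z\<in>?Z. pairing ?N P (coface_form K z) \<le> 0"
    and w: "\<forall>z\<in>?Z. w z \<ge> 0" "\<forall>x\<in>?N. pairing ?N P (down K) \<le> row_gap ?N (?M w) x"
    by (rule row_gap_duality[where A = "down K" and B = "coface_form K", OF fin P0])
  define c where "c = pairing ?N P (down K)"
  \<comment> \<open>The optimal weight vector is realised by a subcomplex, which attains the
    bound.\<close>
  have "c \<le> forman (reweighted k w) x" if "x \<in> ?N" for x
  proof -
    have "forman (reweighted k w) x = row_gap ?N (?M w) x"
      by (rule forman_reweighted[OF that]) (rule w(1)[rule_format])
    with w(2) that show ?thesis by (simp only: c_def)
  qed
  then have "c \<le> Min (forman (reweighted k w) ` ?N)"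
    using ne fin by simp
  moreover have "Min (forman (reweighted k w) ` ?N) \<le> c"
    unfolding c_def by (rule weak[OF cell_complex_reweighted subcomplex_reweighted P])
  ultimately have eq: "Min (forman (reweighted k w) ` ?N) = c" by (rule antisym[rotated])
  then have "c \<in> ?curvatures"
    using cell_complex_reweighted subcomplex_reweighted by blast
  then have max: "is_maximum ?curvatures c"
    using weak P by (auto simp: is_maximum_def c_def)
  \<comment> \<open>The optimal matrix is turned back into an operator; the pairings see only its
    entries over \<open>?N\<close>.\<close>
  obtain J where J: "linear_operator ?N J"
    "\<And>x y. x \<in> ?N \<Longrightarrow> y \<in> ?N \<Longrightarrow> op_matrix J x y = P x y"
    using ex_operator_of_matrix[of k P] by blast
  then have pJ: "pairing ?N (op_matrix J) M = pairing ?N P M" for M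
    by (simp add: pairing_def)
  have "dominated ?N (op_matrix J)" "(\<Sum>x\<in>?N. op_matrix J x x) = 1"
    using P J by (simp_all add: dominated_def)
  then have "c \<in> ?traces"
    unfolding traces using J(1) P(3)
    by (intro CollectI exI[of _ J] conjI) (simp_all add: pJ c_def)
  \<comment> \<open>Weak duality is applied to the optimal subcomplex, whose minimal curvature is
    \<open>c\<close>.\<close>
  moreover have "c \<le> t" if "t \<in> ?traces" for t
  proof -
    from that obtain J' where J': "t = pairing ?N (op_matrix J') (down K)"
      "dominated ?N (op_matrix J')" "\<forall>z\<in>?Z. pairing ?N (op_matrix J') (coface_form K z) \<le> 0"
      "(\<Sum>x\<in>?N. op_matrix J' x x) = 1"
      unfolding traces by blast
    show ?thesis
      using weak[OF cell_complex_reweighted subcomplex_reweighted J'(2,4,3), of w] J'(1)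
eq by simp
  qed
  ultimately have "is_minimum ?traces c" by (simp only: is_minimum_def) blast
  with max show ?thesis by blast
qed

end

theorem theorem4p3:
  fixes K :: "'a complex_data" and k :: nat
  assumes "cell_complex K" and "cells K k \<noteq> {}"
  shows
    "(\<exists>c.
        is_maximum {Min (forman K' ` cells K k) | K'. cell_complex K' \<and> subcomplex_le k K' K} c \<and>
        is_minimum {trace_on (cells K k) (\<lambda>f. cobd K (coadj K (J f))) | J.
            linear_operator (cells K k) J \<and>
            (\<forall>x\<in>cells K k. \<forall>y\<in>cells K k.
               J (indicator {x}) x / weight K x \<ge> \<bar>J (indicator {y}) x\<bar> / weight K y) \<and>
            (\<forall>z\<in>cells K (k + 1). cobd K (J (coadj K (indicator {z}))) z \<le> 0) \<and>
            trace_on (cells K k) J = 1} c) \<and>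
     (\<forall>J. linear_operator (cells K k) J \<longrightarrow>
        ((\<forall>x\<in>cells K k. \<forall>y\<in>cells K k.
           J (indicator {x}) x / weight K x \<ge> \<bar>J (indicator {y}) x\<bar> / weight K y) \<longleftrightarrow>
        (\<forall>x\<in>cells K k. \<forall>f\<in>fun_space (cells K k).
           2 * scalar_prod K (indicator {x}) f \<ge> norm1 K f \<longrightarrow> J f x \<ge> 0)))"
proof -
  interpret cell_complex K by (rule assms(1))
  show ?thesis
  proof (intro conjI allI impI)
    fix J assume "linear_operator (cells K k) J"
    then show "(\<forall>x\<in>cells K k. \<forall>y\<in>cells K k.
           J (indicator {x}) x / weight K x \<ge> \<bar>J (indicator {y}) x\<bar> / weight K y) \<longleftrightarrow>
        (\<forall>x\<in>cells K k. \<forall>f\<in>fun_space (cells K k).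
           2 * scalar_prod K (indicator {x}) f \<ge> norm1 K f \<longrightarrow> J f x \<ge> 0)"
      by (rule dominated_iff_nonneg)
  qed (rule forman_duality[OF assms(2)])
qed

end
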